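(* Let $P(\lambda)=\ell(\lambda)\sum_{i=1}^{k+1}P_i\frac{w_i}{\gamma_i(\lambda)}$, $P_i\in\mathbb{C}^{m\times n}$, be a matrix polynomial expressed in the modified Lagrange basis associated with the nodes $x_1,\ldots,x_{k+1}$. Let $0\le\mu\le k-1$ be an integer, and let $A$ and $B$ be two arbitrary complex matrices of sizes $(\mu+1)m\times(k-\mu-1)n$ and $\mu m\times(k-\mu)n$, respectively. Then the pencil $$L(\lambda)=\begin{bmatrix}M_\mu^L(\lambda)+AK_1^L(\lambda)+K_2^L(\lambda)^TB&K_2^L(\lambda)^T\\ K_1^L(\lambda)&0\end{bmatrix}$$ is a strong linearization of $P(\lambda)$ (considered as a matrix polynomial of grade $k$).
   Context: Lagrange setting. Let $k\ge1$, $m,n\ge1$, and let $x_1,\ldots,x_{k+1}\in\mathbb{C}$ be distinct nodes. Put $\gamma_i(\lambda)=\lambda-x_i$, $\ell(\lambda)=\prod_{i=1}^{k+1}(\lambda-x_i)$ and $w_i=1/\prod_{j\ne i}(x_i-x_j)$. For $0\le\mu\le k-1$, $$K_1^L(\lambda)=\begin{bmatrix}\gamma_{k+1}I_n&-\gamma_{k-1}I_n\\&\gamma_kI_n&-\gamma_{k-2}I_n\\&&\ddots&\ddots\\&&&\gamma_{\mu+3}I_n&-\gamma_{\mu+1}I_n\end{bmatrix},\quad K_2^L(\lambda)=\begin{bmatrix}\gamma_{\mu+2}I_m&-\gamma_{\mu}I_m\\&\gamma_{\mu+1}I_m&-\gamma_{\mu-1}I_m\\&&\ddots&\ddots\\&&&\gamma_3I_m&-\gamma_1I_m\end{bmatrix},$$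 of sizes $(k-\mu-1)n\times(k-\mu)n$ and $\mu m\times(\mu+1)m$ ($K_1^L$ is empty if $\mu=k-1$, $K_2^L$ is empty if $\mu=0$). $M_\mu^L(\lambda)$ is the $(\mu+1)\times(k-\mu)$ block pencil with $m\times n$ blocks: if $\mu<k-1$, its first block row is $[P_{k+1}w_{k+1}\gamma_k+P_kw_k\gamma_{k+1},\ P_{k-1}w_{k-1}\gamma_k,\ P_{k-2}w_{k-2}\gamma_{k-1},\ldots,P_{\mu+1}w_{\mu+1}\gamma_{\mu+2}]$, its last block column has, from top to bottom, blocks $P_{\mu+1}w_{\mu+1}\gamma_{\mu+2},P_\mu w_\mu\gamma_{\mu+1},\ldots,P_2w_2\gamma_3,P_1w_1\gamma_2$, and all other blocks are $0$; if $\mu=k-1$, it is the block column with blocks $P_{k+1}w_{k+1}\gamma_k+P_kw_k\gamma_{k+1},\ P_{k-1}w_{k-1}\gamma_k,\ldots,P_2w_2\gamma_3,P_1w_1\gamma_2$. Linearizations. For a matrix polynomial $Q$ of grade $g$ (i.e. written $\sum_{i=0}^gQ_i\lambda^i$, $Q_g$ possibly zero), $\mathrm{rev}_gQ(\lambda)=\lambda^gQ(1/\lambda)$. A pencil is a matrix polynomial of grade 1. A matrix polynomial is unimodular if it is square with nonzero constant determinant. A pencil $L(\lambda)$ is a linearization of $P(\lambda)$ if $U(\lambda)L(\lambda)V(\lambda)=\mathrm{diag}(I_s,P(\lambda))$ for some integer $s\ge0$ and unimodular $U,V$. It is a strong linearization of the grade-$k$ polynomial $P$ if moreover $\mathrm{rev}_1L$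 is a linearization of $\mathrm{rev}_kP$. *)

theory Defs
  imports Complex_Main "Jordan_Normal_Form.Matrix" "Jordan_Normal_Form.Determinant"
begin

section \<open>Matrix polynomials and linearizations\<close>

text \<open>A complex matrix polynomial in $\lambda$ is a matrix over \<open>complex poly\<close>. Matrices may have
  zero rows or columns; this covers the empty blocks and $I_0$.\<close>

definition has_grade :: "nat \<Rightarrow> complex poly mat \<Rightarrow> bool" where
  "has_grade g Q \<longleftrightarrow> (\<forall>r < dim_row Q. \<forall>c < dim_col Q. degree (Q $$ (r, c)) \<le> g)"

abbreviation pencil :: "complex poly mat \<Rightarrow> bool" where
  "pencil \<equiv> has_grade 1"

definition const_mat :: "complex mat \<Rightarrow> complex poly mat" where
  "const_mat A = map_mat (\<lambda>a. [:a:]) A"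

text \<open>For \<open>degree p \<le> g\<close> this is $\lambda^g p(1/\lambda)$, see \<open>poly_rev_grade\<close> below. It differs
  from \<open>reflect_poly p\<close> when \<open>degree p < g\<close>.\<close>

definition rev_grade :: "nat \<Rightarrow> complex poly \<Rightarrow> complex poly" where
  "rev_grade g p = (\<Sum>i\<le>g. monom (coeff p i) (g - i))"

definition rev_mat :: "nat \<Rightarrow> complex poly mat \<Rightarrow> complex poly mat" where
  "rev_mat g Q = map_mat (rev_grade g) Q"

definition unimodular :: "complex poly mat \<Rightarrow> bool" where
  "unimodular U \<longleftrightarrow> square_mat U \<and> (\<exists>c. c \<noteq> 0 \<and> det U = [:c:])"

text \<open>The \<open>carrier_mat\<close> conditions make $U L V$ a conformable product.\<close>

definition is_linearization :: "complex poly mat \<Rightarrow> complex poly mat \<Rightarrow> bool" where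
  "is_linearization L P \<longleftrightarrow> pencil L \<and>
    (\<exists>s U V. U \<in> carrier_mat (dim_row L) (dim_row L) \<and> unimodular U \<and>
             V \<in> carrier_mat (dim_col L) (dim_col L) \<and> unimodular V \<and>
             U * L * V =
               four_block_mat (1\<^sub>m s) (0\<^sub>m s (dim_col P)) (0\<^sub>m (dim_row P) s) P)"

definition is_strong_linearization :: "nat \<Rightarrow> complex poly mat \<Rightarrow> complex poly mat \<Rightarrow> bool" where
  "is_strong_linearization k L P \<longleftrightarrow>
    has_grade k P \<and> is_linearization L P \<and> is_linearization (rev_mat 1 L) (rev_mat k P)"

section \<open>The modified Lagrange basis\<close>

definition node_factor :: "(nat \<Rightarrow> complex) \<Rightarrow> nat \<Rightarrow> complex poly" where
  "node_factor x i = [:- x i, 1:]"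

definition node_poly :: "nat \<Rightarrow> (nat \<Rightarrow> complex) \<Rightarrow> complex poly" where
  "node_poly k x = (\<Prod>i = 1..k + 1. node_factor x i)"

definition bary_weight :: "nat \<Rightarrow> (nat \<Rightarrow> complex) \<Rightarrow> nat \<Rightarrow> complex" where
  "bary_weight k x i = 1 / (\<Prod>j \<in> {1..k + 1} - {i}. x i - x j)"

text \<open>The polynomial division $\ell / \gamma_i$ is exact, so the entries are the polynomials
  $\ell \sum_i P_i w_i / \gamma_i$, see \<open>poly_lagrange_mat\<close> below.\<close>

definition lagrange_mat ::
  "nat \<Rightarrow> nat \<Rightarrow> nat \<Rightarrow> (nat \<Rightarrow> complex) \<Rightarrow> (nat \<Rightarrow> complex mat) \<Rightarrow> complex poly mat" where
  "lagrange_mat m n k x P = mat m n (\<lambda>(r, c).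
     \<Sum>i = 1..k + 1. smult (P i $$ (r, c) * bary_weight k x i) (node_poly k x div node_factor x i))"

section \<open>The blocks of the pencil\<close>

text \<open>The \<open>p \<times> q\<close> block matrix whose block in position $(i,j)$, counted from 1, is the
  \<open>a \<times> b\<close> matrix \<open>F i j\<close>.\<close>

definition block_matrix :: "nat \<Rightarrow> nat \<Rightarrow> nat \<Rightarrow> nat \<Rightarrow> (nat \<Rightarrow> nat \<Rightarrow> 'a mat) \<Rightarrow> 'a mat" where
  "block_matrix a b p q F = mat (p * a) (q * b)
     (\<lambda>(r, c). F (r div a + 1) (c div b + 1) $$ (r mod a, c mod b))"

definition K1_lagrange :: "nat \<Rightarrow> nat \<Rightarrow> nat \<Rightarrow> (nat \<Rightarrow> complex) \<Rightarrow> complex poly mat" where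
  "K1_lagrange n k \<mu> x = block_matrix n n (k - \<mu> - 1) (k - \<mu>) (\<lambda>i j.
     if j = i then node_factor x (k + 2 - i) \<cdot>\<^sub>m 1\<^sub>m n
     else if j = i + 1 then - (node_factor x (k - i) \<cdot>\<^sub>m 1\<^sub>m n)
     else 0\<^sub>m n n)"

definition K2_lagrange :: "nat \<Rightarrow> nat \<Rightarrow> (nat \<Rightarrow> complex) \<Rightarrow> complex poly mat" where
  "K2_lagrange m \<mu> x = block_matrix m m \<mu> (\<mu> + 1) (\<lambda>i j.
     if j = i then node_factor x (\<mu> + 3 - i) \<cdot>\<^sub>m 1\<^sub>m m
     else if j = i + 1 then - (node_factor x (\<mu> + 1 - i) \<cdot>\<^sub>m 1\<^sub>m m)
     else 0\<^sub>m m m)"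

text \<open>\<open>T i l\<close> stands for $P_i w_i \gamma_l$. For $\mu = k - 1$ there is a single block column; the
  order of the cases then puts the two-term block on top of it and takes the remaining blocks
  from the third case, so no separate definition is needed.\<close>

definition M_lagrange ::
  "nat \<Rightarrow> nat \<Rightarrow> nat \<Rightarrow> nat \<Rightarrow> (nat \<Rightarrow> complex) \<Rightarrow> (nat \<Rightarrow> complex mat) \<Rightarrow> complex poly mat" where
  "M_lagrange m n k \<mu> x P =
    (let T = (\<lambda>i l. node_factor x l \<cdot>\<^sub>m const_mat (bary_weight k x i \<cdot>\<^sub>m P i)) in
     block_matrix m n (\<mu> + 1) (k - \<mu>) (\<lambda>i j.
       if i = 1 \<and> j = 1 then T (k + 1) k + T k (k + 1)
       else if i = 1 then T (k + 1 - j) (k + 2 - j)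
       else if j = k - \<mu> then T (\<mu> + 2 - i) (\<mu> + 3 - i)
       else 0\<^sub>m m n))"

definition L_lagrange ::
  "nat \<Rightarrow> nat \<Rightarrow> nat \<Rightarrow> nat \<Rightarrow> (nat \<Rightarrow> complex) \<Rightarrow> (nat \<Rightarrow> complex mat) \<Rightarrow>
   complex mat \<Rightarrow> complex mat \<Rightarrow> complex poly mat" where
  "L_lagrange m n k \<mu> x P A B =
    (let K1 = K1_lagrange n k \<mu> x; K2T = transpose_mat (K2_lagrange m \<mu> x) in
     four_block_mat
       (M_lagrange m n k \<mu> x P + const_mat A * K1 + K2T * const_mat B)  K2T
       K1                                            (0\<^sub>m ((k - \<mu> - 1) * n) (\<mu> * m)))"

section \<open>Agreement with the pointwise formulas\<close>

lemma poly_rev_grade: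
  assumes "degree p \<le> g" and "z \<noteq> 0"
  shows "poly (rev_grade g p) z = z ^ g * poly p (1 / z)"
proof -
  have "poly p (1 / z) = (\<Sum>i\<le>g. coeff p i * (1 / z) ^ i)"
    using assms(1) by (simp add: poly_altdef sum.mono_neutral_left[of "{..g}" "{..degree p}"] coeff_eq_0)
  then have "z ^ g * poly p (1 / z) = (\<Sum>i\<le>g. coeff p i * (z ^ g * (1 / z) ^ i))"
    by (simp add: sum_distrib_left algebra_simps)
  also have "\<dots> = (\<Sum>i\<le>g. coeff p i * z ^ (g - i))"
    using assms(2) by (intro sum.cong refl) (simp add: power_diff power_one_over field_simps)
  finally show ?thesis
    by (simp add: rev_grade_def poly_sum poly_monom)
qed

lemma poly_lagrange_mat:
  assumes "r < m" and "c < n" and z: "\<And>i. i \<in> {1..k + 1} \<Longrightarrow> z \<noteq> x i"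
  shows "poly (lagrange_mat m n k x P $$ (r, c)) z =
    poly (node_poly k x) z *
      (\<Sum>i = 1..k + 1. P i $$ (r, c) * (bary_weight k x i / poly (node_factor x i) z))"
proof -
  have "poly (node_poly k x div node_factor x i) z = poly (node_poly k x) z / poly (node_factor x i) z"
    if i: "i \<in> {1..k + 1}" for i
  proof -
    have "node_factor x i dvd node_poly k x"
      unfolding node_poly_def using i by (intro dvd_prodI) auto
    then obtain q where q: "node_poly k x = node_factor x i * q" ..
    have "node_factor x i \<noteq> 0" and "poly (node_factor x i) z \<noteq> 0"
      using z[OF i] by (auto simp: node_factor_def)
    then show ?thesis by (simp add: q)
  qed
  then show ?thesis
    using assms(1,2)
    by (auto simp: lagrange_mat_def poly_sum sum_distrib_left mult_ac
        simp del: sum.cl_ivl_Suc intro!: sum.cong)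
qed

end

theory Submission
  imports Defs
begin

text \<open>Up to the factors \<open>I\<^sub>n\<close> and \<open>I\<^sub>m\<close>, the pencils $K_1$ and $K_2$ are bidiagonal matrices whose
  \<open>i\<close>-th diagonal entry is comaximal with the \<open>j\<close>-th superdiagonal entry whenever \<open>i \<le> j\<close>. Such a
  matrix has a polynomial right inverse \<open>G\<close>, and its kernel is spanned by a vector $N$ of products
  of the $\gamma_i$ that has a polynomial left inverse \<open>H\<close>; \<open>G\<close> can be corrected so that $H G = 0$,
  and then $[G \; N]$ is unimodular. With these data
  the pencil is brought to $\mathrm{diag}(I, N_2^T M N_1)$, the terms with \<open>A\<close> and \<open>B\<close> being killed by
  $K_1 N_1 = 0$ and $N_2^T K_2^T = 0$, and $N_2^T M N_1 = P$ is a direct calculation.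

  All this uses only that the $\gamma_i$ are pairwise comaximal of degree at most 1. The reversals
  $1 - x_i \lambda$ are so as well, and reversing the pencil and \<open>P\<close> amounts to replacing each
  $\gamma_i$ by its reversal. Hence the same argument applies to the reversal.\<close>

section \<open>Pencils with completable off-diagonal blocks\<close>

definition hcat :: "'a mat \<Rightarrow> 'a mat \<Rightarrow> 'a mat" where
  "hcat A B = mat (dim_row A) (dim_col A + dim_col B)
     (\<lambda>(i, j). if j < dim_col A then A $$ (i, j) else B $$ (i, j - dim_col A))"

definition vcat :: "'a mat \<Rightarrow> 'a mat \<Rightarrow> 'a mat" where
  "vcat A B = mat (dim_row A + dim_row B) (dim_col A)
     (\<lambda>(i, j). if i < dim_row A then A $$ (i, j) else B $$ (i - dim_row A, j))"

lemma hcat_carrier [simp]: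
  "A \<in> carrier_mat r c1 \<Longrightarrow> B \<in> carrier_mat r c2 \<Longrightarrow> hcat A B \<in> carrier_mat r (c1 + c2)"
  by (auto simp: hcat_def)

lemma vcat_carrier [simp]:
  "A \<in> carrier_mat r1 c \<Longrightarrow> B \<in> carrier_mat r2 c \<Longrightarrow> vcat A B \<in> carrier_mat (r1 + r2) c"
  by (auto simp: vcat_def)

lemma vcat_mult:
  fixes A B C :: "'a :: semiring_0 mat"
  assumes "A \<in> carrier_mat r1 c" "B \<in> carrier_mat r2 c" "C \<in> carrier_mat c d"
  shows "vcat A B * C = vcat (A * C) (B * C)"
  using assms by (intro eq_matI) (auto simp: vcat_def scalar_prod_def)

lemma mult_hcat:
  fixes A B C :: "'a :: semiring_0 mat"
  assumes "A \<in> carrier_mat c d1" "B \<in> carrier_mat c d2" "C \<in> carrier_mat r c"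
  shows "C * hcat A B = hcat (C * A) (C * B)"
  using assms by (intro eq_matI) (auto simp: hcat_def scalar_prod_def)

lemma sum_lessThan_add:
  fixes f :: "nat \<Rightarrow> 'a :: comm_monoid_add"
  shows "(\<Sum>l<a + b. f l) = (\<Sum>l<a. f l) + (\<Sum>l<b. f (a + l))"
  by (induction b) (simp_all add: add.assoc)

text \<open>Writes an index of a block matrix uniquely as \<open>i * d + s\<close>, block number and
  position in the block. Every product of block matrices below is evaluated through this
  splitting.\<close>

lemma sum_lessThan_mult:
  fixes f :: "nat \<Rightarrow> 'a :: comm_monoid_add"
  shows "(\<Sum>l<q * d. f l) = (\<Sum>i<q. \<Sum>s<d. f (i * d + s))"
  by (induction q) (simp_all add: sum_lessThan_add add.commute[of d "_ * d"])

lemma hcat_mult_vcat: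
  fixes A B C D :: "'a :: semiring_0 mat"
  assumes "dim_row A = dim_row B" "dim_col C = dim_col D"
    and "dim_col A = dim_row C" "dim_col B = dim_row D"
  shows "hcat A B * vcat C D = A * C + B * D"
proof (intro eq_matI, goal_cases)
  case (1 i j)
  have "(\<Sum>l<dim_col A + dim_col B. hcat A B $$ (i, l) * vcat C D $$ (l, j)) =
    (\<Sum>l<dim_col A. A $$ (i, l) * C $$ (l, j)) + (\<Sum>l<dim_col B. B $$ (i, l) * D $$ (l, j))"
    using 1 assms
    by (simp add: sum_lessThan_add hcat_def vcat_def)
  then show ?case
    using 1 assms by (auto simp: scalar_prod_def atLeast0LessThan hcat_def vcat_def)
qed (use assms in \<open>auto simp: hcat_def vcat_def\<close>)

lemma four_block_mult_vcat:
  fixes A B C D X Y :: "'a :: semiring_0 mat"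
  assumes "A \<in> carrier_mat r1 c1" "B \<in> carrier_mat r1 c2"
    and "C \<in> carrier_mat r2 c1" "D \<in> carrier_mat r2 c2"
    and "X \<in> carrier_mat c1 d" "Y \<in> carrier_mat c2 d"
  shows "four_block_mat A B C D * vcat X Y = vcat (A * X + B * Y) (C * X + D * Y)"
proof -
  have "four_block_mat A B C D = vcat (hcat A B) (hcat C D)"
    using assms by (intro eq_matI) (auto simp: hcat_def vcat_def)
  then show ?thesis
    using assms by (simp add: vcat_mult[of _ r1 "c1 + c2" _ r2 _ d] hcat_mult_vcat)
qed

text \<open>Reduces a product of three block rows with three block columns to nine block products.
  It serves for \<open>U * U'\<close>, for \<open>V' * V\<close> and for \<open>U\<close> times
  \<open>L * V\<close>.\<close>

lemma mult_three_blocks_diag: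
  fixes u1 u2 u3 v1 v2 v3 :: "'a :: semiring_1 mat"
  assumes u: "u1 \<in> carrier_mat r1 c" "u2 \<in> carrier_mat r2 c" "u3 \<in> carrier_mat a c"
    and v: "v1 \<in> carrier_mat c r1" "v2 \<in> carrier_mat c r2" "v3 \<in> carrier_mat c b"
    and d: "u1 * v1 = 1\<^sub>m r1" "u2 * v2 = 1\<^sub>m r2" "u3 * v3 = Q"
    and z: "u1 * v2 = 0\<^sub>m r1 r2" "u1 * v3 = 0\<^sub>m r1 b" "u2 * v1 = 0\<^sub>m r2 r1"
      "u2 * v3 = 0\<^sub>m r2 b" "u3 * v1 = 0\<^sub>m a r1" "u3 * v2 = 0\<^sub>m a r2"
  shows "vcat (vcat u1 u2) u3 * hcat (hcat v1 v2) v3 =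
    four_block_mat (1\<^sub>m (r1 + r2)) (0\<^sub>m (r1 + r2) b) (0\<^sub>m a (r1 + r2)) Q"
proof -
  have *: "w * hcat (hcat v1 v2) v3 = hcat (hcat (w * v1) (w * v2)) (w * v3)"
    if "w \<in> carrier_mat s c" for w s
    using v that by (simp add: mult_hcat[of _ c "r1 + r2" _ b _ s] mult_hcat[of _ c r1 _ r2 _ s])
  have "vcat (vcat u1 u2) u3 * hcat (hcat v1 v2) v3 =
    vcat (vcat (u1 * hcat (hcat v1 v2) v3) (u2 * hcat (hcat v1 v2) v3)) (u3 * hcat (hcat v1 v2) v3)"
    using u v by (simp add: vcat_mult[of _ "r1 + r2" c _ a _ "r1 + r2 + b"]
        vcat_mult[of _ r1 c _ r2 _ "r1 + r2 + b"])
  moreover have "Q \<in> carrier_mat a b"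
    using u v d by auto
  ultimately show ?thesis
    using u by (simp add: * d z) (intro eq_matI; auto simp: hcat_def vcat_def)
qed

text \<open>The two determinants multiply to 1, so both are units of the polynomial ring, that is,
  nonzero constants.\<close>

lemma unimodular_of_right_inverse:
  assumes "U \<in> carrier_mat n n" "U' \<in> carrier_mat n n" "U * U' = 1\<^sub>m n"
  shows "unimodular U" "unimodular U'"
proof -
  have "det U * det U' = 1"
    using assms by (metis det_mult det_one)
  then have "det U dvd 1" "det U' dvd 1"
    by (metis dvd_triv_left, metis dvd_triv_right)
  then show "unimodular U" "unimodular U'"
    using assms by (auto simp: unimodular_def elim!: is_unit_polyE)
qed

text \<open>The transformations are
  $U = \left[\begin{array}{cc} 0 & I \cr G_2 & 0 \cr N_2 & -N_2 M G_1 \end{array}\right]$ and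
  $V = \left[\begin{array}{ccc} G_1 & 0 & N_1 \cr -G_2 M G_1 & I & -G_2 M N_1 \end{array}\right]$;
  their inverses are built from \<open>K\<^sub>i\<close> and \<open>H\<^sub>i\<close>. Here \<open>K2\<close>, \<open>G2\<close>, \<open>N2\<close>, \<open>H2\<close> play the role of the
  transposes of the second set of data.\<close>
lemma block_minimal_bases_equivalence:
  fixes M K1 G1 N1 H1 K2 G2 N2 H2 :: "complex poly mat"
  assumes dims: "c1 = r1 + n" "c2 = r2 + m"
    and M: "M \<in> carrier_mat c2 c1"
    and c1: "K1 \<in> carrier_mat r1 c1" "G1 \<in> carrier_mat c1 r1" "N1 \<in> carrier_mat c1 n"
      "H1 \<in> carrier_mat n c1"
    and i1: "K1 * G1 = 1\<^sub>m r1" "K1 * N1 = 0\<^sub>m r1 n" "H1 * G1 = 0\<^sub>m n r1" "H1 * N1 = 1\<^sub>m n"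
    and c2: "K2 \<in> carrier_mat c2 r2" "G2 \<in> carrier_mat r2 c2" "N2 \<in> carrier_mat m c2"
      "H2 \<in> carrier_mat c2 m"
    and i2: "G2 * K2 = 1\<^sub>m r2" "N2 * K2 = 0\<^sub>m m r2" "G2 * H2 = 0\<^sub>m r2 m" "N2 * H2 = 1\<^sub>m m"
  shows "\<exists>U V. U \<in> carrier_mat (c2 + r1) (c2 + r1) \<and> unimodular U \<and>
    V \<in> carrier_mat (c1 + r2) (c1 + r2) \<and> unimodular V \<and>
    U * four_block_mat M K2 K1 (0\<^sub>m r1 r2) * V =
      four_block_mat (1\<^sub>m (r1 + r2)) (0\<^sub>m (r1 + r2) n) (0\<^sub>m m (r1 + r2)) (N2 * (M * N1))"
proof -
  note [simp] = c1 c2 M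
  define L where "L = four_block_mat M K2 K1 (0\<^sub>m r1 r2)"
  define Z where "Z = - (N2 * (M * G1))"
  define Y where "Y = - (G2 * (M * G1))"
  define W where "W = - (G2 * (M * N1))"
  define u1 where "u1 = hcat (0\<^sub>m r1 c2) (1\<^sub>m r1 :: complex poly mat)"
  define u2 where "u2 = hcat G2 (0\<^sub>m r2 r1)"
  define u3 where "u3 = hcat N2 Z"
  \<comment> \<open>The entry \<open>- (H2 * Z)\<close> cancels \<open>Z\<close> in
    \<open>u3 * u1'\<close> because \<open>N2 * H2\<close> is the identity, and it is invisible to
    \<open>u2\<close> because \<open>G2 * H2 = 0\<close>.\<close>
  define u1' where "u1' = vcat (- (H2 * Z)) (1\<^sub>m r1)"
  define u2' where "u2' = vcat K2 (0\<^sub>m r1 r2)"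
  define u3' where "u3' = vcat H2 (0\<^sub>m r1 m)"
  define v1 where "v1 = vcat G1 Y"
  define v2 where "v2 = vcat (0\<^sub>m c1 r2) (1\<^sub>m r2 :: complex poly mat)"
  define v3 where "v3 = vcat N1 W"
  define v1' where "v1' = hcat K1 (0\<^sub>m r1 r2)"
  define v2' where "v2' = hcat (G2 * M) (1\<^sub>m r2)"
  define v3' where "v3' = hcat H1 (0\<^sub>m n r2)"
  define U where "U = vcat (vcat u1 u2) u3"
  define U' where "U' = hcat (hcat u1' u2') u3'"
  define V where "V = hcat (hcat v1 v2) v3"
  define V' where "V' = vcat (vcat v1' v2') v3'"
  have L: "L \<in> carrier_mat (c2 + r1) (c1 + r2)"
    unfolding L_def by (rule four_block_carrier_mat) auto
  have MG: "M * G1 \<in> carrier_mat c2 r1" and MN: "M * N1 \<in> carrier_mat c2 n"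
    and GM: "G2 * M \<in> carrier_mat r2 c1"
    by (rule mult_carrier_mat[OF M c1(2)] mult_carrier_mat[OF M c1(3)] mult_carrier_mat[OF c2(2) M])+
  note [simp] = MG MN GM
  have Zc: "Z \<in> carrier_mat m r1" and Yc: "Y \<in> carrier_mat r2 r1" and Wc: "W \<in> carrier_mat r2 n"
    unfolding Z_def Y_def W_def
    by (rule uminus_carrier_mat mult_carrier_mat[OF _ MG] mult_carrier_mat[OF _ MN] c2)+
  note [simp] = Zc Yc Wc
  have HZ: "H2 * Z \<in> carrier_mat c2 r1" and KY: "K2 * Y \<in> carrier_mat c2 r1"
    and KW: "K2 * W \<in> carrier_mat c2 n"
    by (rule mult_carrier_mat[OF _ Zc] mult_carrier_mat[OF _ Yc] mult_carrier_mat[OF _ Wc] c2)+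
  note [simp] = HZ KY KW
  note car = c1 c2 M MG MN GM Zc Yc Wc HZ KY KW
  note car' = car car[THEN uminus_carrier_mat]
  note [simp] = car'[THEN left_mult_zero_mat] car'[THEN right_mult_zero_mat]
    car'[THEN left_mult_one_mat] car'[THEN right_mult_one_mat]
    car'[THEN left_add_zero_mat] car'[THEN right_add_zero_mat] car[THEN uminus_l_inv_mat]
  have GHZ: "G2 * (H2 * Z) = 0\<^sub>m r2 r1" and NHZ: "N2 * (H2 * Z) = Z"
    by (simp_all add: i2 assoc_mult_mat[OF c2(2) c2(4) Zc, symmetric]
        assoc_mult_mat[OF c2(3) c2(4) Zc, symmetric])
  have GKY: "G2 * (K2 * Y) = Y" and NKY: "N2 * (K2 * Y) = 0\<^sub>m m r1"
    by (simp_all add: i2 assoc_mult_mat[OF c2(2) c2(1) Yc, symmetric]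
        assoc_mult_mat[OF c2(3) c2(1) Yc, symmetric])
  have GKW: "G2 * (K2 * W) = W" and NKW: "N2 * (K2 * W) = 0\<^sub>m m n"
    by (simp_all add: i2 assoc_mult_mat[OF c2(2) c2(1) Wc, symmetric]
        assoc_mult_mat[OF c2(3) c2(1) Wc, symmetric])
  have neg: "G2 * (M * G1) = - Y" "G2 * (M * N1) = - W" "N2 * (M * G1) = - Z"
    "G2 * M * G1 = - Y" "G2 * M * N1 = - W"
    by (simp_all add: Y_def W_def Z_def assoc_mult_mat[OF c2(2) M c1(2)] assoc_mult_mat[OF c2(2) M c1(3)])
  \<comment> \<open>\<open>G2 * K2\<close> is the identity, so \<open>Y\<close> and \<open>W\<close>
    cancel what \<open>G2\<close> sees of \<open>M\<close>. \<open>N2\<close> annihilates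
    \<open>K2\<close>, so the last row keeps only \<open>N2 * (M * G1)\<close>, which
    \<open>Z\<close> cancels later, and the target \<open>N2 * (M * N1)\<close>.\<close>
  have GMY: "G2 * (M * G1 + K2 * Y) = 0\<^sub>m r2 r1" and NMY: "N2 * (M * G1 + K2 * Y) = - Z"
    and GMW: "G2 * (M * N1 + K2 * W) = 0\<^sub>m r2 n" and NMW: "N2 * (M * N1 + K2 * W) = N2 * (M * N1)"
    by (simp_all add: mult_add_distrib_mat[OF c2(2) MG KY] mult_add_distrib_mat[OF c2(3) MG KY]
        mult_add_distrib_mat[OF c2(2) MN KW] mult_add_distrib_mat[OF c2(3) MN KW]
        GKY NKY GKW NKW neg
        right_add_zero_mat[OF mult_carrier_mat[OF c2(3) MN]])
  have uc: "u1 \<in> carrier_mat r1 (c2 + r1)" "u2 \<in> carrier_mat r2 (c2 + r1)" "u3 \<in> carrier_mat m (c2 + r1)"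
    by (auto simp: u1_def u2_def u3_def)
  have uc': "u1' \<in> carrier_mat (c2 + r1) r1" "u2' \<in> carrier_mat (c2 + r1) r2"
    "u3' \<in> carrier_mat (c2 + r1) m"
    by (auto simp: u1'_def u2'_def u3'_def intro!: vcat_carrier uminus_carrier_mat)
  have vc: "v1 \<in> carrier_mat (c1 + r2) r1" "v2 \<in> carrier_mat (c1 + r2) r2" "v3 \<in> carrier_mat (c1 + r2) n"
    by (auto simp: v1_def v2_def v3_def)
  have vc': "v1' \<in> carrier_mat r1 (c1 + r2)" "v2' \<in> carrier_mat r2 (c1 + r2)"
    "v3' \<in> carrier_mat n (c1 + r2)"
    by (auto simp: v1'_def v2'_def v3'_def intro!: hcat_carrier)
  have Lv: "L * v1 = vcat (M * G1 + K2 * Y) (1\<^sub>m r1)" "L * v2 = vcat K2 (0\<^sub>m r1 r2)"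
    "L * v3 = vcat (M * N1 + K2 * W) (0\<^sub>m r1 n)"
    unfolding L_def v1_def v2_def v3_def
    by (simp_all add: i1 four_block_mult_vcat[OF M c2(1) c1(1) zero_carrier_mat c1(2) Yc]
        four_block_mult_vcat[OF M c2(1) c1(1) zero_carrier_mat c1(3) Wc]
        four_block_mult_vcat[OF M c2(1) c1(1) zero_carrier_mat zero_carrier_mat one_carrier_mat])
  have Lvc: "L * v1 \<in> carrier_mat (c2 + r1) r1" "L * v2 \<in> carrier_mat (c2 + r1) r2"
    "L * v3 \<in> carrier_mat (c2 + r1) n"
    using L vc by (auto intro: mult_carrier_mat)
  \<comment> \<open>\<open>U\<close> is square because its block heights \<open>r1\<close>,
    \<open>r2\<close>, \<open>m\<close> add up to \<open>c2 + r1\<close>; the equations in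
    \<open>dims\<close> do the same for the other three matrices.\<close>
  have Uc: "U \<in> carrier_mat (c2 + r1) (c2 + r1)"
    using vcat_carrier[OF vcat_carrier[OF uc(1,2)] uc(3)] dims by (simp add: U_def ac_simps)
  have Uc': "U' \<in> carrier_mat (c2 + r1) (c2 + r1)"
    using hcat_carrier[OF hcat_carrier[OF uc'(1,2)] uc'(3)] dims by (simp add: U'_def ac_simps)
  have Vc: "V \<in> carrier_mat (c1 + r2) (c1 + r2)"
    using hcat_carrier[OF hcat_carrier[OF vc(1,2)] vc(3)] dims by (simp add: V_def ac_simps)
  have Vc': "V' \<in> carrier_mat (c1 + r2) (c1 + r2)"
    using vcat_carrier[OF vcat_carrier[OF vc'(1,2)] vc'(3)] dims by (simp add: V'_def ac_simps)
  note [simp] = hcat_mult_vcat car[THEN carrier_matD(1)] car[THEN carrier_matD(2)]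
  have neg_zero: "- 0\<^sub>m p q = (0\<^sub>m p q :: complex poly mat)" for p q
    by (intro eq_matI) auto
  have one: "four_block_mat (1\<^sub>m p) (0\<^sub>m p q) (0\<^sub>m q p) (1\<^sub>m q) = (1\<^sub>m (p + q) :: complex poly mat)" for p q
    by (intro eq_matI) auto
  have "U * U' = 1\<^sub>m (r1 + r2 + m)"
    unfolding U_def U'_def
    by (rule trans[OF mult_three_blocks_diag[OF uc uc'] one];
        simp add: u1_def u2_def u3_def u1'_def u2'_def u3'_def i2 GHZ NHZ neg_zero)
  then have "U * U' = 1\<^sub>m (c2 + r1)"
    using dims by (simp add: ac_simps)
  then have U: "unimodular U"
    using unimodular_of_right_inverse[OF Uc Uc'] by blast
  have "V' * V = 1\<^sub>m (r1 + r2 + n)"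
    unfolding V_def V'_def
    by (rule trans[OF mult_three_blocks_diag[OF vc' vc] one];
        simp add: v1_def v2_def v3_def v1'_def v2'_def v3'_def i1 neg)
  then have "V' * V = 1\<^sub>m (c1 + r2)"
    using dims by (simp add: ac_simps)
  then have V: "unimodular V"
    using unimodular_of_right_inverse[OF Vc' Vc] by blast
  have "L * V = hcat (hcat (L * v1) (L * v2)) (L * v3)"
    unfolding V_def using L vc
    by (simp add: mult_hcat[of _ "c1 + r2" "r1 + r2" _ n _ "c2 + r1"] mult_hcat[of _ "c1 + r2" r1 _ r2 _ "c2 + r1"])
  then have "U * L * V = U * hcat (hcat (L * v1) (L * v2)) (L * v3)"
    using Uc L Vc by (simp add: assoc_mult_mat)
  also have "\<dots> = four_block_mat (1\<^sub>m (r1 + r2)) (0\<^sub>m (r1 + r2) n) (0\<^sub>m m (r1 + r2)) (N2 * (M * N1))"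
    unfolding U_def
    by (rule mult_three_blocks_diag[OF uc Lvc];
        simp add: Lv u1_def u2_def u3_def i2 GMY NMY GMW NMW
         right_add_zero_mat[OF mult_carrier_mat[OF c2(3) MN]])
  finally show ?thesis
    using Uc Vc U V unfolding L_def by blast
qed

section \<open>Tensor products with an identity matrix\<close>

text \<open>The Kronecker product of \<open>S\<close> with the identity of size \<open>d\<close>;
  quotient and remainder by \<open>d\<close> are the block number and the position in the
  block.\<close>

definition kron_id :: "nat \<Rightarrow> 'a :: zero mat \<Rightarrow> 'a mat" where
  "kron_id d S = mat (dim_row S * d) (dim_col S * d)
     (\<lambda>(r, c). if r mod d = c mod d then S $$ (r div d, c div d) else 0)"

lemma kron_id_carrier [simp]: "S \<in> carrier_mat p q \<Longrightarrow> kron_id d S \<in> carrier_mat (p * d) (q * d)"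
  by (auto simp: kron_id_def)

lemma block_index_less:
  fixes i q t d :: nat
  assumes "i < q" "t < d"
  shows "i * d + t < q * d"
proof -
  have "i * d + t < Suc i * d"
    using assms by simp
  also have "\<dots> \<le> q * d"
    using assms by (intro mult_le_mono1) simp
  finally show ?thesis .
qed

text \<open>The mixed-product rule: in the sum over \<open>i * d + t\<close> only
  \<open>t = r mod d\<close> survives. It transfers all identities between scalar bidiagonal data to
  the block pencils.\<close>

lemma kron_id_mult:
  fixes S T :: "'a :: comm_semiring_1 mat"
  assumes "S \<in> carrier_mat p q" "T \<in> carrier_mat q s"
  shows "kron_id d S * kron_id d T = kron_id d (S * T)"
proof (intro eq_matI, goal_cases)
  case (1 r c)
  then have rc: "r < p * d" "c < s * d" and d: "d > 0"
    using assms by (auto simp: kron_id_def intro: Nat.gr0I)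
  then have div: "r div d < p" "c div d < s"
    by (auto intro: less_mult_imp_div_less)
  have "(kron_id d S * kron_id d T) $$ (r, c) =
    (\<Sum>l<q * d. kron_id d S $$ (r, l) * kron_id d T $$ (l, c))"
    using rc assms by (auto simp: scalar_prod_def kron_id_def atLeast0LessThan)
  also have "\<dots> = (\<Sum>i<q. \<Sum>t<d. if t = r mod d then
      (if r mod d = c mod d then S $$ (r div d, i) * T $$ (i, c div d) else 0) else 0)"
    unfolding sum_lessThan_mult using rc assms block_index_less
    by (intro sum.cong refl) (auto simp: kron_id_def)
  also have "\<dots> = (if r mod d = c mod d then (S * T) $$ (r div d, c div d) else 0)"
    using d assms div by (simp add: sum.delta scalar_prod_def atLeast0LessThan)
  finally show ?case
    using rc assms by (simp add: kron_id_def)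
qed (use assms in \<open>auto simp: kron_id_def\<close>)

lemma kron_id_one: "kron_id d (1\<^sub>m p) = (1\<^sub>m (p * d) :: 'a :: semiring_1 mat)"
proof (intro eq_matI, goal_cases)
  case (1 r c)
  have "(r mod d = c mod d \<and> r div d = c div d) = (r = c)"
    by (metis div_mult_mod_eq)
  then show ?case
    using 1 by (auto simp: kron_id_def less_mult_imp_div_less)
qed (auto simp: kron_id_def)

lemma kron_id_zero: "kron_id d (0\<^sub>m p q) = (0\<^sub>m (p * d) (q * d) :: 'a :: semiring_1 mat)"
  by (intro eq_matI) (auto simp: kron_id_def less_mult_imp_div_less)

lemma kron_id_transpose: "transpose_mat (kron_id d S) = kron_id d (transpose_mat S)"
  by (intro eq_matI) (auto simp: kron_id_def less_mult_imp_div_less)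

text \<open>The identity factors pick position \<open>(r, c)\<close> in every block, so the product
  is a sum of the blocks with scalar weights. This is the shape of N_2^T M N_1.\<close>

lemma row_column_block_matrix:
  fixes S T :: "'a :: comm_semiring_1 mat"
  assumes S: "S \<in> carrier_mat 1 p" and T: "T \<in> carrier_mat q 1" and r: "r < a" and c: "c < b"
  shows "(kron_id a S * (block_matrix a b p q F * kron_id b T)) $$ (r, c) =
    (\<Sum>i<p. \<Sum>j<q. S $$ (0, i) * T $$ (j, 0) * F (i + 1) (j + 1) $$ (r, c))"
proof -
  let ?M = "block_matrix a b p q F"
  have MT: "(?M * kron_id b T) $$ (i * a + r, c) = (\<Sum>j<q. F (i + 1) (j + 1) $$ (r, c) * T $$ (j, 0))"
    if i: "i < p" for i
  proof -
    have "(?M * kron_id b T) $$ (i * a + r, c) =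
      (\<Sum>l<q * b. ?M $$ (i * a + r, l) * kron_id b T $$ (l, c))"
      using T c block_index_less[OF i r] by (auto simp: scalar_prod_def kron_id_def block_matrix_def atLeast0LessThan)
    also have "\<dots> = (\<Sum>j<q. \<Sum>t<b. if t = c then F (i + 1) (j + 1) $$ (r, c) * T $$ (j, 0) else 0)"
      unfolding sum_lessThan_mult using T c r block_index_less[OF i r] block_index_less
      by (intro sum.cong refl) (auto simp: kron_id_def block_matrix_def)
    finally show ?thesis
      using c by (simp add: sum.delta)
  qed
  have "(kron_id a S * (?M * kron_id b T)) $$ (r, c) =
    (\<Sum>l<p * a. kron_id a S $$ (r, l) * (?M * kron_id b T) $$ (l, c))"
    using S T r c by (simp add: scalar_prod_def kron_id_def block_matrix_def atLeast0LessThan)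
  also have "\<dots> = (\<Sum>i<p. \<Sum>t<a. if t = r then S $$ (0, i) * (?M * kron_id b T) $$ (i * a + r, c) else 0)"
    unfolding sum_lessThan_mult using S r block_index_less
    by (intro sum.cong refl) (auto simp: kron_id_def)
  finally show ?thesis
    using r by (simp add: sum.delta MT sum_distrib_left mult_ac)
qed

section \<open>Bidiagonal matrices\<close>

text \<open>The principal ideals of \<open>p\<close> and \<open>q\<close> together generate the
  ring. The explicit coefficients are what the inverses below are built from.\<close>

definition comaximal :: "'a :: comm_ring_1 \<Rightarrow> 'a \<Rightarrow> bool" where
  "comaximal p q \<longleftrightarrow> (\<exists>s t. s * p + t * q = 1)"

lemma comaximal_commute: "comaximal p q \<longleftrightarrow> comaximal q p"
  unfolding comaximal_def by (metis add.commute)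

lemma comaximal_one: "comaximal 1 r"
  unfolding comaximal_def by (rule exI[of _ 1], rule exI[of _ 0]) simp

text \<open>In the product of the two Bezout identities every term except the one with
  \<open>p * q\<close> contains \<open>r\<close>.\<close>

lemma comaximal_mult: "comaximal p r \<Longrightarrow> comaximal q r \<Longrightarrow> comaximal (p * q) r"
proof -
  assume "comaximal p r" "comaximal q r"
  then obtain s t s' t' where "s * p + t * r = 1" "s' * q + t' * r = 1"
    by (auto simp: comaximal_def)
  then have "(s * p + t * r) * (s' * q + t' * r) = 1"
    by simp
  then have "(s * s') * (p * q) + (s * p * t' + t * s' * q + t * r * t') * r = 1"
    by (simp add: algebra_simps)
  then show ?thesis
    unfolding comaximal_def by blast
qed

lemma comaximal_prod:
  assumes "\<And>i. i \<in> I \<Longrightarrow> comaximal (p i) r"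
  shows "comaximal (prod p I) r"
proof (cases "finite I")
  case True
  then show ?thesis
    using assms
    by (induction I) (auto simp: comaximal_one intro: comaximal_mult)
qed (simp_all add: comaximal_one)

definition bidiag :: "nat \<Rightarrow> (nat \<Rightarrow> 'a :: comm_ring_1) \<Rightarrow> (nat \<Rightarrow> 'a) \<Rightarrow> 'a mat" where
  "bidiag N p q = mat N (N + 1) (\<lambda>(i, j). if j = i then p i else if j = i + 1 then - q i else 0)"

text \<open>A division-free solution \<open>a\<close> of the recurrence
  \<open>p i * a i = q i * a (i + 1)\<close> imposed by the rows of \<open>bidiag\<close>.\<close>

definition bidiag_kernel :: "nat \<Rightarrow> (nat \<Rightarrow> 'a :: comm_ring_1) \<Rightarrow> (nat \<Rightarrow> 'a) \<Rightarrow> 'a mat" where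
  "bidiag_kernel N p q = mat (N + 1) 1 (\<lambda>(j, _). prod p {..<j} * prod q {j..<N})"

lemma bidiag_mult_index:
  assumes "X \<in> carrier_mat (N + 1) d" "i < N" "j < d"
  shows "(bidiag N p q * X) $$ (i, j) = p i * X $$ (i, j) - q i * X $$ (Suc i, j)"
proof -
  have "(bidiag N p q * X) $$ (i, j) = (\<Sum>l<N + 1. bidiag N p q $$ (i, l) * X $$ (l, j))"
    using assms by (simp add: scalar_prod_def bidiag_def atLeast0LessThan)
  also have "\<dots> = (\<Sum>l\<in>{i, Suc i}. bidiag N p q $$ (i, l) * X $$ (l, j))"
    using assms by (intro sum.mono_neutral_right) (auto simp: bidiag_def)
  finally show ?thesis
    using assms by (simp add: bidiag_def)
qed

lemma bidiag_carrier [simp]: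
  "bidiag N p q \<in> carrier_mat N (N + 1)" "bidiag_kernel N p q \<in> carrier_mat (N + 1) 1"
  by (auto simp: bidiag_def bidiag_kernel_def)

lemma bidiag_mult_kernel: "bidiag N p q * bidiag_kernel N p q = 0\<^sub>m N 1"
proof (intro eq_matI, goal_cases)
  case (1 i j)
  then have "i < N" "j = 0" by auto
  then show ?case
    by (simp add: bidiag_mult_index[of _ _ 1] bidiag_kernel_def prod.atLeast_Suc_lessThan[of i N] mult_ac)
qed (auto simp: bidiag_def bidiag_kernel_def)

text \<open>Passing from \<open>N\<close> to \<open>N + 1\<close> multiplies the old entries by
  \<open>q N\<close> and appends the product of \<open>p 0\<close> to \<open>p N\<close>. The old
  combination then yields \<open>q N\<close>, which is comaximal with the new entry. The
  coefficients \<open>h\<close> form the left inverse of the kernel vector.\<close>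

lemma bidiag_kernel_unimodular:
  fixes p q :: "nat \<Rightarrow> 'a :: comm_ring_1"
  assumes "\<And>i j. i \<le> j \<Longrightarrow> j < N \<Longrightarrow> comaximal (p i) (q j)"
  shows "\<exists>h. (\<Sum>j\<le>N. h j * (prod p {..<j} * prod q {j..<N})) = 1"
  using assms
proof (induction N)
  case 0
  then show ?case by (auto intro!: exI[of _ "\<lambda>_. 1"])
next
  case (Suc N)
  then obtain h where h: "(\<Sum>j\<le>N. h j * (prod p {..<j} * prod q {j..<N})) = 1"
    by fastforce
  have "comaximal (prod p {..<Suc N}) (q N)"
    using Suc.prems by (intro comaximal_prod) auto
  then obtain s t where st: "s * prod p {..<Suc N} + t * q N = 1"
    by (auto simp: comaximal_def)
  define h' where "h' j = (if j = Suc N then s else t * h j)" for j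
  have "(\<Sum>j\<le>Suc N. h' j * (prod p {..<j} * prod q {j..<Suc N})) =
    (\<Sum>j\<le>N. t * q N * (h j * (prod p {..<j} * prod q {j..<N}))) + s * prod p {..<Suc N}"
    by (auto simp: h'_def mult_ac intro!: sum.cong)
  also have "\<dots> = 1"
    using st by (simp add: sum_distrib_left[symmetric] h add.commute)
  finally show ?case by blast
qed

text \<open>Column \<open>i\<close> of the right inverse solves a two-term recurrence away from row \<open>i\<close>; the
  jump at row \<open>i\<close> is a Bezout identity for \<open>p\<^sub>0 \<dots> p\<^sub>i\<close> and \<open>q\<^sub>i \<dots> q\<^sub>N\<^sub>-\<^sub>1\<close>.\<close>
lemma bidiag_right_inverse:
  fixes p q :: "nat \<Rightarrow> 'a :: comm_ring_1"
  assumes "\<And>i j. i \<le> j \<Longrightarrow> j < N \<Longrightarrow> comaximal (p i) (q j)"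
  shows "\<exists>G \<in> carrier_mat (N + 1) N. bidiag N p q * G = 1\<^sub>m N"
proof -
  \<comment> \<open>Indices in the first product are at most \<open>i\<close> and those in the
    second at least \<open>i\<close>, so the hypothesis covers every pair of factors.\<close>
  have "\<exists>s t. s * prod p {..i} + t * prod q {i..<N} = 1" if "i < N" for i
  proof -
    have "comaximal (q j) (prod p {..i})" if "j \<in> {i..<N}" for j
      using that assms by (subst comaximal_commute) (auto intro!: comaximal_prod)
    then have "comaximal (prod p {..i}) (prod q {i..<N})"
      by (subst comaximal_commute) (rule comaximal_prod)
    then show ?thesis
      by (simp add: comaximal_def)
  qed
  then obtain s t where st: "\<And>i. i < N \<Longrightarrow> s i * prod p {..i} + t i * prod q {i..<N} = 1"
    by metis
  \<comment> \<open>Column \<open>i\<close> joins \<open>s i\<close> times the kernel vector of the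
    rows before \<open>i\<close> to \<open>- t i\<close> times the kernel vector of the rows after
    \<open>i\<close>.\<close>
  define G where "G = mat (N + 1) N (\<lambda>(l, i).
    if l \<le> i then s i * prod p {..<l} * prod q {l..<i}
    else - t i * prod p {Suc i..<l} * prod q {l..<N})"
  have "bidiag N p q * G = 1\<^sub>m N"
  proof (intro eq_matI, goal_cases)
    case (1 i j)
    then have ij: "i < N" "j < N" by auto
    have eq: "(bidiag N p q * G) $$ (i, j) = p i * G $$ (i, j) - q i * G $$ (Suc i, j)"
      using ij by (intro bidiag_mult_index) (auto simp: G_def)
    consider "i < j" | "i = j" | "i > j" by linarith
    then show ?case
    proof cases
      case 1
      then show ?thesis
        unfolding eq using ij by (simp add: G_def prod.atLeast_Suc_lessThan[of i j] mult_ac)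
    next
      case 2
      then show ?thesis
        unfolding eq using ij st[of i]
        by (simp add: G_def prod.atLeast_Suc_lessThan[of j N] lessThan_Suc_atMost[symmetric] mult_ac)
    next
      case 3
      then show ?thesis
        unfolding eq using ij by (simp add: G_def prod.atLeast_Suc_lessThan[of i N] mult_ac)
    qed
  qed (auto simp: G_def bidiag_def)
  moreover have "G \<in> carrier_mat (N + 1) N"
    by (simp add: G_def)
  ultimately show ?thesis by blast
qed

text \<open>Writing \<open>a\<close> for the kernel vector, any right inverse \<open>G\<close> is
  replaced by \<open>G - a * (H * G)\<close>. This is still a right inverse since
  \<open>bidiag N p q * a = 0\<close>, and \<open>H\<close> annihilates it since
  \<open>H * a\<close> is the identity.\<close>

lemma bidiag_completion:
  fixes p q :: "nat \<Rightarrow> 'a :: comm_ring_1"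
  assumes "\<And>i j. i \<le> j \<Longrightarrow> j < N \<Longrightarrow> comaximal (p i) (q j)"
  obtains G H where "G \<in> carrier_mat (N + 1) N" "H \<in> carrier_mat 1 (N + 1)"
    "bidiag N p q * G = 1\<^sub>m N" "H * G = 0\<^sub>m 1 N" "H * bidiag_kernel N p q = 1\<^sub>m 1"
proof -
  let ?K = "bidiag N p q" and ?a = "bidiag_kernel N p q"
  obtain G where G: "G \<in> carrier_mat (N + 1) N" "?K * G = 1\<^sub>m N"
    using bidiag_right_inverse[of N p q] assms by blast
  obtain h where h: "(\<Sum>j\<le>N. h j * (prod p {..<j} * prod q {j..<N})) = 1"
    using bidiag_kernel_unimodular[of N p q] assms by blast
  define H where "H = mat 1 (N + 1) (\<lambda>(_, j). h j)"
  have H: "H \<in> carrier_mat 1 (N + 1)"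
    by (simp add: H_def)
  have Ha: "H * ?a = 1\<^sub>m 1"
    using h by (intro eq_matI)
      (auto simp: H_def bidiag_kernel_def scalar_prod_def atLeast0_lessThan_Suc atLeast0LessThan
        lessThan_Suc_atMost)
  have a: "?a \<in> carrier_mat (N + 1) 1" and K: "?K \<in> carrier_mat N (N + 1)"
    by (rule bidiag_carrier)+
  have HG: "H * G \<in> carrier_mat 1 N" and aHG: "?a * (H * G) \<in> carrier_mat (N + 1) N"
    using H G a by (auto intro!: mult_carrier_mat)
  have "?K * (G - ?a * (H * G)) = 1\<^sub>m N"
    using G HG H
    by (simp add: mult_minus_distrib_mat[OF K G(1) aHG] assoc_mult_mat[OF K a HG, symmetric]
        bidiag_mult_kernel left_mult_zero_mat[OF HG] minus_r_inv_mat)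
      (intro eq_matI; simp)
  moreover have "H * (G - ?a * (H * G)) = 0\<^sub>m 1 N"
    by (simp add: mult_minus_distrib_mat[OF H G(1) aHG] assoc_mult_mat[OF H a HG, symmetric] Ha
        left_mult_one_mat[OF HG] minus_r_inv_mat[OF HG]
        del: One_nat_def)
  moreover have "G - ?a * (H * G) \<in> carrier_mat (N + 1) N"
    using aHG by (rule minus_carrier_mat)
  ultimately show ?thesis
    using that H Ha by blast
qed

section \<open>Reversal\<close>

lemma rev_grade_linear:
  "rev_grade g 0 = 0"
  "rev_grade g (p + q) = rev_grade g p + rev_grade g q"
  "rev_grade g (- p) = - rev_grade g p"
  "rev_grade g (smult a p) = smult a (rev_grade g p)"
proof -
  show "rev_grade g (smult a p) = smult a (rev_grade g p)"
    by (rule poly_eqI) (auto simp: rev_grade_def coeff_sum sum_distrib_left intro!: sum.cong)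
qed (simp_all add: rev_grade_def add_monom[symmetric] sum.distrib minus_monom[symmetric] sum_negf)

lemma rev_grade_sum: "rev_grade g (\<Sum>i\<in>I. f i) = (\<Sum>i\<in>I. rev_grade g (f i))"
  by (induction I rule: infinite_finite_induct) (simp_all add: rev_grade_linear)

lemma degree_rev_grade_le: "degree (rev_grade g p) \<le> g"
  unfolding rev_grade_def by (intro degree_sum_le) (auto intro: order.trans[OF degree_monom_le])

text \<open>Infinitely many common values suffice. The point 0 has to be left out because
  \<open>poly_rev_grade\<close> evaluates reversals only away from it.\<close>

lemma poly_eqI_nonzero:
  fixes p q :: "complex poly"
  assumes "\<And>z. z \<noteq> 0 \<Longrightarrow> poly p z = poly q z"
  shows "p = q"
proof (rule ccontr)
  assume "p \<noteq> q"
  then have "finite {z. poly (p - q) z = 0}"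
    by (intro poly_roots_finite) simp
  moreover have "- {0} \<subseteq> {z. poly (p - q) z = 0}"
    using assms by auto
  ultimately have "finite (- {0 :: complex})"
    by (rule finite_subset[rotated])
  then show False
    using infinite_UNIV_char_0 by (metis finite_Diff2 Compl_eq_Diff_UNIV finite.emptyI finite_insert)
qed

lemma degree_prod_le_card:
  fixes f :: "'b \<Rightarrow> 'a :: comm_semiring_1 poly"
  assumes "finite S" "\<And>s. s \<in> S \<Longrightarrow> degree (f s) \<le> 1"
  shows "degree (prod f S) \<le> card S"
  using order.trans[OF degree_prod_sum_le[OF assms(1), of f] sum_mono[of S "degree \<circ> f" "\<lambda>_. 1"]] assms
  by auto

text \<open>Away from 0 the power \<open>z ^ card S\<close> hands one \<open>z\<close> to each
  factor. The grade counts factors, so factors of degree 0 are allowed.\<close>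

lemma rev_grade_prod:
  assumes "finite S" "\<And>s. s \<in> S \<Longrightarrow> degree (f s) \<le> 1"
  shows "rev_grade (card S) (prod f S) = (\<Prod>s\<in>S. rev_grade 1 (f s))"
  using degree_prod_le_card[OF assms] assms
  by (intro poly_eqI_nonzero) (simp add: poly_rev_grade poly_prod prod.distrib)

section \<open>The pencil over an arbitrary family of factors\<close>

text \<open>Here \<open>g i\<close> replaces $\gamma_i$, so that \<open>g\<close> can also be the family of reversals, and \<open>C i\<close> stands
  for $w_i P_i$.\<close>

definition gen_K1 :: "nat \<Rightarrow> nat \<Rightarrow> nat \<Rightarrow> (nat \<Rightarrow> 'a :: comm_ring_1) \<Rightarrow> 'a mat" where
  "gen_K1 n k \<mu> g = kron_id n (bidiag (k - \<mu> - 1) (\<lambda>i. g (k + 1 - i)) (\<lambda>i. g (k - 1 - i)))"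

definition gen_K2 :: "nat \<Rightarrow> nat \<Rightarrow> (nat \<Rightarrow> 'a :: comm_ring_1) \<Rightarrow> 'a mat" where
  "gen_K2 m \<mu> g = kron_id m (bidiag \<mu> (\<lambda>i. g (\<mu> + 2 - i)) (\<lambda>i. g (\<mu> - i)))"

definition gen_M :: "nat \<Rightarrow> nat \<Rightarrow> nat \<Rightarrow> nat \<Rightarrow> (nat \<Rightarrow> complex poly) \<Rightarrow> (nat \<Rightarrow> complex mat) \<Rightarrow>
    complex poly mat" where
  "gen_M m n k \<mu> g C =
    (let T = (\<lambda>i l. g l \<cdot>\<^sub>m const_mat (C i)) in
     block_matrix m n (\<mu> + 1) (k - \<mu>) (\<lambda>i j.
       if i = 1 \<and> j = 1 then T (k + 1) k + T k (k + 1)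
       else if i = 1 then T (k + 1 - j) (k + 2 - j)
       else if j = k - \<mu> then T (\<mu> + 2 - i) (\<mu> + 3 - i)
       else 0\<^sub>m m n))"

definition gen_L :: "nat \<Rightarrow> nat \<Rightarrow> nat \<Rightarrow> nat \<Rightarrow> (nat \<Rightarrow> complex poly) \<Rightarrow> (nat \<Rightarrow> complex mat) \<Rightarrow>
    complex mat \<Rightarrow> complex mat \<Rightarrow> complex poly mat" where
  "gen_L m n k \<mu> g C A B = four_block_mat
     (gen_M m n k \<mu> g C + const_mat A * gen_K1 n k \<mu> g + transpose_mat (gen_K2 m \<mu> g) * const_mat B)
     (transpose_mat (gen_K2 m \<mu> g)) (gen_K1 n k \<mu> g) (0\<^sub>m ((k - \<mu> - 1) * n) (\<mu> * m))"

text \<open>The factor \<open>g i\<close> is omitted rather than divided out, so each product has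
  exactly \<open>k\<close> factors and can be reversed factor by factor.\<close>

definition gen_P :: "nat \<Rightarrow> nat \<Rightarrow> nat \<Rightarrow> (nat \<Rightarrow> complex poly) \<Rightarrow> (nat \<Rightarrow> complex mat) \<Rightarrow>
    complex poly mat" where
  "gen_P m n k g C = mat m n (\<lambda>(r, c).
     \<Sum>i = 1..k + 1. smult (C i $$ (r, c)) (prod g ({1..k + 1} - {i})))"

section \<open>Specialization to the factors \<lambda> - x_i\<close>

lemma K1_lagrange_eq: "\<mu> < k \<Longrightarrow> K1_lagrange n k \<mu> x = gen_K1 n k \<mu> (node_factor x)"
  unfolding K1_lagrange_def gen_K1_def
  by (cases "n = 0"; intro eq_matI)
    (auto simp: block_matrix_def kron_id_def bidiag_def less_mult_imp_div_less Suc_diff_Suc)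

lemma K2_lagrange_eq: "K2_lagrange m \<mu> x = gen_K2 m \<mu> (node_factor x)"
  unfolding K2_lagrange_def gen_K2_def
  by (cases "m = 0"; intro eq_matI) (auto simp: block_matrix_def kron_id_def bidiag_def less_mult_imp_div_less)

lemma L_lagrange_eq:
  "\<mu> < k \<Longrightarrow> L_lagrange m n k \<mu> x P A B =
    gen_L m n k \<mu> (node_factor x) (\<lambda>i. bary_weight k x i \<cdot>\<^sub>m P i) A B"
  by (simp add: L_lagrange_def gen_L_def M_lagrange_def gen_M_def K1_lagrange_eq K2_lagrange_eq Let_def)

text \<open>The division by \<open>node_factor x i\<close> is exact and just removes one factor of
  \<open>node_poly k x\<close>.\<close>

lemma lagrange_mat_eq:
  assumes "\<And>i. i \<in> {1..k + 1} \<Longrightarrow> P i \<in> carrier_mat m n"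
  shows "lagrange_mat m n k x P = gen_P m n k (node_factor x) (\<lambda>i. bary_weight k x i \<cdot>\<^sub>m P i)"
proof -
  have "node_poly k x div node_factor x i = prod (node_factor x) ({1..k + 1} - {i})" if "i \<in> {1..k + 1}" for i
  proof -
    have "node_factor x i \<noteq> 0"
      by (simp add: node_factor_def)
    moreover have "node_poly k x = node_factor x i * prod (node_factor x) ({1..k + 1} - {i})"
      using that unfolding node_poly_def by (intro prod.remove) auto
    ultimately show ?thesis by simp
  qed
  moreover have "dim_row (P i) = m" "dim_col (P i) = n" if "i \<in> {1..k + 1}" for i
    using assms[OF that] by auto
  ultimately show ?thesis
    unfolding lagrange_mat_def gen_P_def
    by (intro eq_matI) (auto simp del: sum.cl_ivl_Suc intro!: sum.cong simp: mult.commute)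
qed

lemma gen_carrier:
  assumes "\<mu> < k"
  shows "gen_K1 n k \<mu> g \<in> carrier_mat ((k - \<mu> - 1) * n) ((k - \<mu>) * n)"
    "gen_K2 m \<mu> g \<in> carrier_mat (\<mu> * m) ((\<mu> + 1) * m)"
    "gen_M m n k \<mu> g' C \<in> carrier_mat ((\<mu> + 1) * m) ((k - \<mu>) * n)"
  using assms
  by (auto simp: gen_K1_def gen_K2_def gen_M_def Let_def kron_id_def bidiag_def block_matrix_def
      Suc_diff_Suc)

lemma const_mat_carrier [simp]: "A \<in> carrier_mat a b \<Longrightarrow> const_mat A \<in> carrier_mat a b"
  by (auto simp: const_mat_def)

text \<open>Moves the case distinction from blocks to polynomial entries, the form in which both the
  reversal and N_2^T M N_1 are computed.\<close>

lemma gen_M_index: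
  assumes C: "\<And>i. i \<in> {1..k + 1} \<Longrightarrow> C i \<in> carrier_mat m n" and "\<mu> < k"
    and "r < (\<mu> + 1) * m" "c < (k - \<mu>) * n"
  shows "gen_M m n k \<mu> g C $$ (r, c) =
    (let i = r div m + 1; j = c div n + 1; f = \<lambda>i l. smult (C i $$ (r mod m, c mod n)) (g l) in
       if i = 1 \<and> j = 1 then f (k + 1) k + f k (k + 1)
       else if i = 1 then f (k + 1 - j) (k + 2 - j)
       else if j = k - \<mu> then f (\<mu> + 2 - i) (\<mu> + 3 - i)
       else 0)"
proof -
  have "m > 0" "n > 0"
    using assms(3,4) by (auto intro: Nat.gr0I)
  then have mn: "r mod m < m" "c mod n < n"
    by simp_all
  have ij: "r div m < \<mu> + 1" "c div n < k - \<mu>"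
    using assms by (auto intro: less_mult_imp_div_less)
  have T: "const_mat (C i) $$ (r mod m, c mod n) = [:C i $$ (r mod m, c mod n):]"
    "dim_row (const_mat (C i)) = m" "dim_col (const_mat (C i)) = n"
    if "i \<in> {1..k + 1}" for i
    using C[OF that] mn by (auto simp: const_mat_def)
  \<comment> \<open>These are the subscripts of \<open>C\<close> that can occur, since the block
    indices counted from 1 are \<open>r div m + 1\<close> and \<open>c div n + 1\<close>.\<close>
  have "Suc \<mu> - r div m \<in> {1..k + 1}" "k - c div n \<in> {1..k + 1}" "k \<in> {1..k + 1}" "Suc k \<in> {1..k + 1}"
    using ij assms(2) by auto
  note this[THEN T(1)] this[THEN T(2)] this[THEN T(3)]
  then show ?thesis
    using assms(2-) mn ij
    by (auto simp: gen_M_def block_matrix_def Let_def)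
qed

section \<open>Reversal of the pencil and of the polynomial\<close>

lemma rev_mat_add:
  "X \<in> carrier_mat a b \<Longrightarrow> Y \<in> carrier_mat a b \<Longrightarrow> rev_mat g (X + Y) = rev_mat g X + rev_mat g Y"
  by (intro eq_matI) (auto simp: rev_mat_def rev_grade_linear)

lemma rev_mat_carrier [simp]: "X \<in> carrier_mat a b \<Longrightarrow> rev_mat g X \<in> carrier_mat a b"
  by (auto simp: rev_mat_def)

lemma const_mat_mult_index:
  assumes "A \<in> carrier_mat a b" "X \<in> carrier_mat b c" "i < a" "j < c"
  shows "(const_mat A * X) $$ (i, j) = (\<Sum>l<b. smult (A $$ (i, l)) (X $$ (l, j)))"
  using assms by (auto simp: scalar_prod_def const_mat_def atLeast0LessThan)

text \<open>Reversal at a fixed grade is not multiplicative, but it is linear over the constants,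
  which is enough for a constant factor.\<close>

lemma rev_mat_const_mult:
  assumes "A \<in> carrier_mat a b" "X \<in> carrier_mat b c"
  shows "rev_mat g (const_mat A * X) = const_mat A * rev_mat g X"
proof (intro eq_matI, goal_cases)
  case (1 i j)
  then have "i < a" "j < c"
    using assms by (auto simp: const_mat_def rev_mat_def)
  then show ?case
    using assms const_mat_mult_index[OF assms] const_mat_mult_index[OF assms(1) rev_mat_carrier[OF assms(2)]]
    by (simp add: rev_mat_def const_mat_def rev_grade_sum rev_grade_linear)
qed (auto simp: rev_mat_def)

lemma rev_mat_transpose: "rev_mat g (transpose_mat X) = transpose_mat (rev_mat g X)"
  by (intro eq_matI) (auto simp: rev_mat_def)

lemma transpose_const_mat: "transpose_mat (const_mat A) = const_mat (transpose_mat A)"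
  by (intro eq_matI) (auto simp: const_mat_def)

text \<open>Transposition reduces a constant factor on the right to one on the left.\<close>

lemma mult_const_mat_eq:
  assumes "X \<in> carrier_mat a b" "B \<in> carrier_mat b c"
  shows "X * const_mat B = transpose_mat (const_mat (transpose_mat B) * transpose_mat X)"
  using assms by (simp add: transpose_mult[of _ c b _ a] transpose_const_mat)

lemma rev_mat_gen_K: "rev_mat 1 (gen_K1 n k \<mu> g) = gen_K1 n k \<mu> (\<lambda>i. rev_grade 1 (g i))"
    "rev_mat 1 (gen_K2 m \<mu> g) = gen_K2 m \<mu> (\<lambda>i. rev_grade 1 (g i))"
  by (intro eq_matI; auto simp: gen_K1_def gen_K2_def rev_mat_def kron_id_def bidiag_def rev_grade_linear
      less_mult_imp_div_less)+

lemma rev_mat_gen_M: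
  assumes "\<And>i. i \<in> {1..k + 1} \<Longrightarrow> C i \<in> carrier_mat m n" and "\<mu> < k"
  shows "rev_mat 1 (gen_M m n k \<mu> g C) = gen_M m n k \<mu> (\<lambda>i. rev_grade 1 (g i)) C"
proof (intro eq_matI, goal_cases)
  case (1 i j)
  then have ij: "i < (\<mu> + 1) * m" "j < (k - \<mu>) * n"
    using gen_carrier(3)[OF assms(2)] by (metis carrier_matD(1), metis carrier_matD(2))
  have "rev_mat 1 (gen_M m n k \<mu> g C) $$ (i, j) = rev_grade 1 (gen_M m n k \<mu> g C $$ (i, j))"
    using ij gen_carrier(3)[OF assms(2), of m n g C] by (simp add: rev_mat_def)
  then show ?case
    by (simp only: gen_M_index[OF assms ij] Let_def if_distrib[of "rev_grade 1"] rev_grade_linear)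
qed (simp_all add: rev_mat_def gen_M_def Let_def block_matrix_def)

text \<open>Every block is linear in the \<open>g i\<close> with constant coefficients, so reversal
  acts on the \<open>g i\<close> alone and the same \<open>A\<close> and \<open>B\<close>
  reappear.\<close>

lemma rev_mat_gen_L:
  assumes C: "\<And>i. i \<in> {1..k + 1} \<Longrightarrow> C i \<in> carrier_mat m n" and mu: "\<mu> < k"
    and A: "A \<in> carrier_mat ((\<mu> + 1) * m) ((k - \<mu> - 1) * n)"
    and B: "B \<in> carrier_mat (\<mu> * m) ((k - \<mu>) * n)"
  shows "rev_mat 1 (gen_L m n k \<mu> g C A B) = gen_L m n k \<mu> (\<lambda>i. rev_grade 1 (g i)) C A B"
proof -
  note K1 = gen_carrier(1)[OF mu, of n g] and K2 = gen_carrier(2)[OF mu, of m g]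
    and M = gen_carrier(3)[OF mu, of m n g C]
  have K2T: "transpose_mat (gen_K2 m \<mu> g) \<in> carrier_mat ((\<mu> + 1) * m) (\<mu> * m)"
    using K2 by simp
  have BT: "transpose_mat B \<in> carrier_mat ((k - \<mu>) * n) (\<mu> * m)"
    using B by simp
  have AK: "const_mat A * gen_K1 n k \<mu> g \<in> carrier_mat ((\<mu> + 1) * m) ((k - \<mu>) * n)"
    and KB: "transpose_mat (gen_K2 m \<mu> g) * const_mat B \<in> carrier_mat ((\<mu> + 1) * m) ((k - \<mu>) * n)"
    using A B K1 K2T by (auto intro: mult_carrier_mat simp: const_mat_def)
  have four: "rev_mat 1 (four_block_mat X Y Z (0\<^sub>m a b)) =
      four_block_mat (rev_mat 1 X) (rev_mat 1 Y) (rev_mat 1 Z) (0\<^sub>m a b)"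
    if "dim_row Y = dim_row X" "dim_col Z = dim_col X" "dim_col Y = b" "dim_row Z = a" for X Y Z a b
    using that by (intro eq_matI) (auto simp: rev_mat_def rev_grade_linear)
  have rev_KB: "rev_mat 1 (transpose_mat (gen_K2 m \<mu> g) * const_mat B) =
      transpose_mat (gen_K2 m \<mu> (\<lambda>i. rev_grade 1 (g i))) * const_mat B"
    using K2 gen_carrier(2)[OF mu, of m "\<lambda>i. rev_grade 1 (g i)"]
    by (simp add: mult_const_mat_eq[OF _ B, of _ "(\<mu> + 1) * m"] rev_mat_transpose
        rev_mat_const_mult[OF BT] rev_mat_gen_K[unfolded One_nat_def])
  have rev_AK: "rev_mat 1 (const_mat A * gen_K1 n k \<mu> g) =
      const_mat A * gen_K1 n k \<mu> (\<lambda>i. rev_grade 1 (g i))"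
    by (simp only: rev_mat_const_mult[OF A K1] rev_mat_gen_K)
  have rev_sum: "rev_mat 1 (gen_M m n k \<mu> g C + const_mat A * gen_K1 n k \<mu> g +
        transpose_mat (gen_K2 m \<mu> g) * const_mat B) =
      rev_mat 1 (gen_M m n k \<mu> g C) + rev_mat 1 (const_mat A * gen_K1 n k \<mu> g) +
      rev_mat 1 (transpose_mat (gen_K2 m \<mu> g) * const_mat B)"
    using rev_mat_add[OF add_carrier_mat[OF AK] KB] rev_mat_add[OF M AK] by simp
  have "rev_mat 1 (gen_L m n k \<mu> g C A B) = four_block_mat
     (rev_mat 1 (gen_M m n k \<mu> g C + const_mat A * gen_K1 n k \<mu> g + transpose_mat (gen_K2 m \<mu> g) * const_mat B))
     (rev_mat 1 (transpose_mat (gen_K2 m \<mu> g))) (rev_mat 1 (gen_K1 n k \<mu> g))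
     (0\<^sub>m ((k - \<mu> - 1) * n) (\<mu> * m))"
    unfolding gen_L_def using K1 K2 KB B by (intro four) (auto simp: const_mat_def)
  then show ?thesis
    by (simp only: gen_L_def rev_sum rev_AK rev_KB rev_mat_gen_M[OF C mu] rev_mat_gen_K rev_mat_transpose)
qed

lemma rev_mat_gen_P:
  assumes "\<And>i. degree (g i) \<le> 1"
  shows "rev_mat k (gen_P m n k g C) = gen_P m n k (\<lambda>i. rev_grade 1 (g i)) C"
proof -
  have "rev_grade k (prod g ({1..k + 1} - {i})) = (\<Prod>j\<in>{1..k + 1} - {i}. rev_grade 1 (g j))"
    if "i \<in> {1..k + 1}" for i
    using rev_grade_prod[of "{1..k + 1} - {i}" g] that assms by simp
  then show ?thesis
    by (intro eq_matI)
      (auto simp: rev_mat_def gen_P_def rev_grade_sum rev_grade_linear simp del: sum.cl_ivl_Suc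
        intro!: sum.cong)
qed

lemma has_grade_gen_P:
  assumes "\<And>i. degree (g i) \<le> 1"
  shows "has_grade k (gen_P m n k g C)"
proof -
  have "degree (prod g ({1..k + 1} - {i})) \<le> k" if "i \<in> {1..k + 1}" for i
    using degree_prod_le_card[of "{1..k + 1} - {i}" g] that assms by simp
  then show ?thesis
    by (auto simp: has_grade_def gen_P_def simp del: sum.cl_ivl_Suc
        intro!: degree_sum_le order.trans[OF degree_smult_le])
qed

section \<open>The product N_2^T M N_1\<close>

lemma prod_diff_reindex:
  fixes N c :: nat
  assumes "N \<le> c"
  shows "(\<Prod>t\<in>{j..<N}. g (c - t)) = prod g {c - N<..c - j}"
  using assms by (intro prod.reindex_bij_witness[of _ "\<lambda>s. c - s" "\<lambda>t. c - t"]) auto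

lemma sum_diff_reindex:
  fixes N c :: nat
  assumes "N \<le> c"
  shows "(\<Sum>t<N. f (c - t)) = sum f {c - N<..c}"
  using assms by (intro sum.reindex_bij_witness[of _ "\<lambda>s. c - s" "\<lambda>t. c - t"]) auto

text \<open>Block \<open>(i, j)\<close>, counted from 0, receives the weight
  \<open>b i * a j\<close>. For a nonzero block this weight times its linear factor is the product
  of all \<open>g\<close> but one, so each term \<open>C i\<close> of \<open>gen_M\<close> yields
  exactly the summand of \<open>gen_P\<close> with the same subscript.\<close>

lemma gen_M_dual:
  fixes g :: "nat \<Rightarrow> complex poly"
  assumes C: "\<And>i. i \<in> {1..k + 1} \<Longrightarrow> C i \<in> carrier_mat m n" and mu: "\<mu> < k"
  defines "a \<equiv> bidiag_kernel (k - \<mu> - 1) (\<lambda>i. g (k + 1 - i)) (\<lambda>i. g (k - 1 - i))"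
    and "b \<equiv> bidiag_kernel \<mu> (\<lambda>i. g (\<mu> + 2 - i)) (\<lambda>i. g (\<mu> - i))"
  shows "kron_id m (transpose_mat b) * (gen_M m n k \<mu> g C * kron_id n a) = gen_P m n k g C"
proof (intro eq_matI, goal_cases)
  case (1 r c)
  then have r: "r < m" and c: "c < n"
    by (auto simp: gen_P_def)
  define N where "N = k - \<mu> - 1"
  have N: "k - \<mu> = Suc N" "N \<le> k - 1" "N \<le> k + 1" "k - 1 - N = \<mu>" "k + 1 - N = \<mu> + 2"
    using mu by (auto simp: N_def)
  \<comment> \<open>\<open>aa j\<close> is the product of the \<open>g\<close> with indices from
    \<open>\<mu> + 1\<close> to \<open>k + 1\<close> except \<open>k - j\<close> and
    \<open>k + 1 - j\<close>; \<open>bb i\<close> that of the \<open>g\<close> with indices from 1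
    to \<open>\<mu> + 2\<close> except \<open>\<mu> + 1 - i\<close> and
    \<open>\<mu> + 2 - i\<close>.\<close>
  define aa where "aa j = prod g {k + 1 - j<..k + 1} * prod g {\<mu><..k - 1 - j}" for j
  define bb where "bb i = prod g {\<mu> + 2 - i<..\<mu> + 2} * prod g {0<..\<mu> - i}" for i
  have a: "a $$ (j, 0) = aa j" if "j < Suc N" for j
    using that N prod_diff_reindex[of j "k + 1" g 0] prod_diff_reindex[of N "k - 1" g j]
    by (simp add: a_def aa_def bidiag_kernel_def N_def[symmetric] atLeast0LessThan)
  have b: "b $$ (i, 0) = bb i" if "i < Suc \<mu>" for i
    using that prod_diff_reindex[of i "\<mu> + 2" g 0] prod_diff_reindex[of \<mu> \<mu> g i]
    by (simp add: b_def bb_def bidiag_kernel_def atLeast0LessThan)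
  have ac: "a \<in> carrier_mat (Suc N) 1" and bc: "transpose_mat b \<in> carrier_mat 1 (Suc \<mu>)"
    using mu by (auto simp: a_def b_def bidiag_kernel_def N_def)
  define omit where "omit i = prod g ({1..k + 1} - {i})" for i
  define f where "f i = smult (C i $$ (r, c)) (omit i)" for i
  define F where "F i j = (let f = \<lambda>i l. smult (C i $$ (r, c)) (g l) in
       if i = 1 \<and> j = 1 then f (k + 1) k + f k (k + 1)
       else if i = 1 then f (k + 1 - j) (k + 2 - j)
       else if j = k - \<mu> then f (\<mu> + 2 - i) (\<mu> + 3 - i)
       else 0)" for i j
  \<comment> \<open>The weight of a nonzero block misses two neighbouring factors, and the linear
    factor in the block restores one of them. In the corner either one is restored, by its two
    terms.\<close>
  have omit_k: "aa 0 * bb 0 * g k = omit (k + 1)" "aa 0 * bb 0 * g (k + 1) = omit k"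
  proof -
    have s: "{1..k + 1} - {k + 1} = insert k ({\<mu><..k - 1} \<union> {0<..\<mu>})"
      "{1..k + 1} - {k} = insert (k + 1) ({\<mu><..k - 1} \<union> {0<..\<mu>})"
      using mu by auto
    show "aa 0 * bb 0 * g k = omit (k + 1)" "aa 0 * bb 0 * g (k + 1) = omit k"
      unfolding omit_def s using mu
      by (subst prod.insert, simp, force, subst prod.union_disjoint; auto simp: aa_def bb_def mult_ac)+
  qed
  have omit_row: "aa j * bb 0 * g (k + 1 - j) = omit (k - j)" if j: "j \<in> {1..N}" for j
  proof -
    have s: "{1..k + 1} - {k - j} =
        insert (k + 1 - j) ({k + 1 - j<..k + 1} \<union> ({\<mu><..k - 1 - j} \<union> {0<..\<mu>}))"
      using mu j by (auto simp: N_def)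
    show ?thesis
      unfolding omit_def s using mu j
      by (subst prod.insert, simp, force simp: N_def, subst prod.union_disjoint, simp, simp, force simp: N_def,
          subst prod.union_disjoint; auto simp: aa_def bb_def mult_ac)
  qed
  have omit_col: "aa N * bb i * g (\<mu> + 2 - i) = omit (\<mu> + 1 - i)" if i: "i \<in> {1..\<mu>}" for i
  proof -
    have s: "{1..k + 1} - {\<mu> + 1 - i} =
        insert (\<mu> + 2 - i) ({\<mu> + 2<..k + 1} \<union> ({\<mu> + 2 - i<..\<mu> + 2} \<union> {0<..\<mu> - i}))"
      using mu i by auto
    show ?thesis
      unfolding omit_def s using mu i N
      by (subst prod.insert, simp, force, subst prod.union_disjoint, simp, simp, force,
          subst prod.union_disjoint; auto simp: aa_def bb_def mult_ac)
  qed
  have "(kron_id m (transpose_mat b) * (gen_M m n k \<mu> g C * kron_id n a)) $$ (r, c) =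
    (\<Sum>i<Suc \<mu>. \<Sum>j<Suc N. bb i * aa j * F (i + 1) (j + 1))"
  proof -
    have ab: "transpose_mat b $$ (0, i) = bb i" if "i < Suc \<mu>" for i
      using b that bc by simp
    define F' where "F' i j = (let T = (\<lambda>i l. g l \<cdot>\<^sub>m const_mat (C i)) in
       if i = 1 \<and> j = 1 then T (k + 1) k + T k (k + 1)
       else if i = 1 then T (k + 1 - j) (k + 2 - j)
       else if j = k - \<mu> then T (\<mu> + 2 - i) (\<mu> + 3 - i)
       else 0\<^sub>m m n)" for i j
    have M: "gen_M m n k \<mu> g C = block_matrix m n (Suc \<mu>) (Suc N) F'"
      unfolding gen_M_def F'_def using N by (simp add: Let_def)
    have "F' (i + 1) (j + 1) $$ (r, c) = F (i + 1) (j + 1)" if ij: "i < Suc \<mu>" "j < Suc N" for i j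
    proof -
      have lt: "i * m + r < (\<mu> + 1) * m" "j * n + c < (k - \<mu>) * n"
        using block_index_less[of i "\<mu> + 1" r m] block_index_less[of j "k - \<mu>" c n] ij r c N by auto
      have "F' (i + 1) (j + 1) $$ (r, c) = gen_M m n k \<mu> g C $$ (i * m + r, j * n + c)"
        using lt r c N by (simp add: M block_matrix_def)
      also have "\<dots> = F (i + 1) (j + 1)"
        using gen_M_index[OF C mu lt, where g = g] r c by (simp add: F_def Let_def)
      finally show ?thesis .
    qed
    then show ?thesis
      unfolding M row_column_block_matrix[OF bc ac r c]
      by (intro sum.cong refl) (simp add: a ab)
  qed
  \<comment> \<open>The first block row supplies the summands \<open>k + 1\<close> down to
    \<open>\<mu> + 1\<close>. Each later row has only its last block, and these supply
    \<open>\<mu>\<close> down to 1.\<close>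
  also have "\<dots> = (\<Sum>j<Suc N. bb 0 * aa j * F 1 (j + 1)) +
      (\<Sum>i<\<mu>. \<Sum>j<Suc N. bb (Suc i) * aa j * F (Suc i + 1) (j + 1))"
    by (subst sum.lessThan_Suc_shift) simp
  also have "(\<Sum>j<Suc N. bb 0 * aa j * F 1 (j + 1)) = f (k + 1) + f k + (\<Sum>j<N. f (k - 1 - j))"
  proof -
    have "bb 0 * aa 0 * F 1 1 = f (k + 1) + f k"
      using omit_k by (simp add: F_def f_def Let_def algebra_simps)
    moreover have "bb 0 * aa (Suc j) * F 1 (Suc j + 1) = f (k - 1 - j)" if "j < N" for j
      using omit_row[of "Suc j"] that by (simp add: F_def f_def Let_def mult_ac)
    ultimately show ?thesis
      by (subst sum.lessThan_Suc_shift) simp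
  qed
  also have "(\<Sum>i<\<mu>. \<Sum>j<Suc N. bb (Suc i) * aa j * F (Suc i + 1) (j + 1)) = (\<Sum>i<\<mu>. f (\<mu> - i))"
  proof (intro sum.cong refl)
    fix i assume i: "i \<in> {..<\<mu>}"
    have "(\<Sum>j<N. bb (Suc i) * aa j * F (Suc i + 1) (j + 1)) = 0"
      using N by (intro sum.neutral) (auto simp: F_def Let_def)
    moreover have "bb (Suc i) * aa N * F (Suc i + 1) (N + 1) = f (\<mu> - i)"
      using omit_col[of "Suc i"] i N by (simp add: F_def f_def Let_def mult_ac)
    ultimately show "(\<Sum>j<Suc N. bb (Suc i) * aa j * F (Suc i + 1) (j + 1)) = f (\<mu> - i)"
      by simp
  qed
  also have "(\<Sum>j<N. f (k - 1 - j)) = sum f {\<mu><..k - 1}"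
    using sum_diff_reindex[of N "k - 1" f] N by simp
  also have "(\<Sum>i<\<mu>. f (\<mu> - i)) = sum f {0<..\<mu>}"
    using sum_diff_reindex[of \<mu> \<mu> f] by simp
  also have "f (k + 1) + f k + sum f {\<mu><..k - 1} + sum f {0<..\<mu>} = sum f {1..k + 1}"
  proof -
    have "{1..k + 1} = insert (k + 1) (insert k ({\<mu><..k - 1} \<union> {0<..\<mu>}))"
      using mu by auto
    then show ?thesis
      using mu by (simp add: sum.union_disjoint add_ac)
  qed
  also have "\<dots> = gen_P m n k g C $$ (r, c)"
    using r c by (simp add: gen_P_def f_def omit_def del: sum.cl_ivl_Suc)
  finally show ?case .
qed (simp_all add: gen_P_def kron_id_def b_def a_def bidiag_kernel_def)

section \<open>Linearization for pairwise comaximal factors\<close>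

text \<open>Reversal at grade 1 is an involution on degree at most 1. The pencil is therefore itself
  a reversal, and reversals at grade 1 have entries of degree at most 1.\<close>

lemma pencil_gen_L:
  assumes C: "\<And>i. i \<in> {1..k + 1} \<Longrightarrow> C i \<in> carrier_mat m n" and mu: "\<mu> < k"
    and A: "A \<in> carrier_mat ((\<mu> + 1) * m) ((k - \<mu> - 1) * n)"
    and B: "B \<in> carrier_mat (\<mu> * m) ((k - \<mu>) * n)"
    and g: "\<And>i. degree (g i) \<le> 1"
  shows "pencil (gen_L m n k \<mu> g C A B)"
proof -
  have "rev_grade 1 (rev_grade 1 p) = p" if "degree p \<le> 1" for p
    using that degree_rev_grade_le[of 1 p]
    by (intro poly_eqI_nonzero) (simp add: poly_rev_grade)
  then have "gen_L m n k \<mu> g C A B = rev_mat 1 (gen_L m n k \<mu> (\<lambda>i. rev_grade 1 (g i)) C A B)"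
    using rev_mat_gen_L[OF C mu A B, where g = "\<lambda>i. rev_grade 1 (g i)"] g by simp
  then show ?thesis
    by (simp add: has_grade_def rev_mat_def degree_rev_grade_le)
qed

lemma is_linearization_gen_L:
  assumes C: "\<And>i. i \<in> {1..k + 1} \<Longrightarrow> C i \<in> carrier_mat m n" and mu: "\<mu> < k"
    and A: "A \<in> carrier_mat ((\<mu> + 1) * m) ((k - \<mu> - 1) * n)"
    and B: "B \<in> carrier_mat (\<mu> * m) ((k - \<mu>) * n)"
    and g: "\<And>i. degree (g i) \<le> 1"
    and coprime: "\<And>i j. i \<in> {1..k + 1} \<Longrightarrow> j \<in> {1..k + 1} \<Longrightarrow> i \<noteq> j \<Longrightarrow> comaximal (g i) (g j)"
  shows "is_linearization (gen_L m n k \<mu> g C A B) (gen_P m n k g C)"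
proof -
  define r1 r2 c1 c2 where "r1 = (k - \<mu> - 1) * n" and "r2 = \<mu> * m" and "c1 = (k - \<mu>) * n"
    and "c2 = (\<mu> + 1) * m"
  define N where "N = k - \<mu> - 1"
  have N: "k - \<mu> = N + 1"
    using mu by (simp add: N_def)
  define a where "a = bidiag_kernel N (\<lambda>i. g (k + 1 - i)) (\<lambda>i. g (k - 1 - i))"
  define b where "b = bidiag_kernel \<mu> (\<lambda>i. g (\<mu> + 2 - i)) (\<lambda>i. g (\<mu> - i))"
  define S1 where "S1 = bidiag N (\<lambda>i. g (k + 1 - i)) (\<lambda>i. g (k - 1 - i))"
  define S2 where "S2 = bidiag \<mu> (\<lambda>i. g (\<mu> + 2 - i)) (\<lambda>i. g (\<mu> - i))"
  \<comment> \<open>For \<open>i \<le> j\<close> the index \<open>k + 1 - i\<close> exceeds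
    \<open>k - 1 - j\<close>, so the two entries are distinct factors; the same holds for
    \<open>\<mu> + 2 - i\<close> and \<open>\<mu> - j\<close> below.\<close>
  obtain G1 H1 where 1: "G1 \<in> carrier_mat (N + 1) N" "H1 \<in> carrier_mat 1 (N + 1)"
    "S1 * G1 = 1\<^sub>m N" "H1 * G1 = 0\<^sub>m 1 N" "H1 * a = 1\<^sub>m 1"
    unfolding S1_def a_def
    by (rule bidiag_completion[of N "\<lambda>i. g (k + 1 - i)" "\<lambda>i. g (k - 1 - i)"])
      (auto simp: N_def intro!: coprime)
  obtain G2 H2 where 2: "G2 \<in> carrier_mat (\<mu> + 1) \<mu>" "H2 \<in> carrier_mat 1 (\<mu> + 1)"
    "S2 * G2 = 1\<^sub>m \<mu>" "H2 * G2 = 0\<^sub>m 1 \<mu>" "H2 * b = 1\<^sub>m 1"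
    unfolding S2_def b_def
    by (rule bidiag_completion[of \<mu> "\<lambda>i. g (\<mu> + 2 - i)" "\<lambda>i. g (\<mu> - i)"])
      (use mu in \<open>auto intro!: coprime\<close>)
  have S: "S1 \<in> carrier_mat N (N + 1)" "S2 \<in> carrier_mat \<mu> (\<mu> + 1)"
    and ab: "a \<in> carrier_mat (N + 1) 1" "b \<in> carrier_mat (\<mu> + 1) 1"
    unfolding S1_def S2_def a_def b_def by (rule bidiag_carrier)+
  have Sa: "S1 * a = 0\<^sub>m N 1" "S2 * b = 0\<^sub>m \<mu> 1"
    unfolding S1_def S2_def a_def b_def by (rule bidiag_mult_kernel)+
  let ?T = transpose_mat
  define K1 where "K1 = gen_K1 n k \<mu> g"
  define K2T where "K2T = ?T (gen_K2 m \<mu> g)"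
  define N1 where "N1 = kron_id n a"
  define N2 where "N2 = kron_id m (?T b)"
  define M where "M = gen_M m n k \<mu> g C"
  define X where "X = M + const_mat A * K1 + K2T * const_mat B"
  have K1: "K1 = kron_id n S1" and K2T: "K2T = kron_id m (?T S2)"
    by (simp_all add: K1_def gen_K1_def S1_def N_def K2T_def gen_K2_def S2_def kron_id_transpose)
  have T2: "?T G2 * ?T S2 = 1\<^sub>m \<mu>" "?T G2 * ?T H2 = 0\<^sub>m \<mu> 1" "?T b * ?T H2 = 1\<^sub>m 1" "?T b * ?T S2 = 0\<^sub>m 1 \<mu>"
    by (simp_all only: transpose_mult[OF S(2) 2(1), symmetric] transpose_mult[OF 2(2) 2(1), symmetric]
        transpose_mult[OF 2(2) ab(2), symmetric] transpose_mult[OF S(2) ab(2), symmetric] 2(3-5) Sa(2)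
        transpose_one zero_transpose_mat)
  have T2c: "?T G2 \<in> carrier_mat \<mu> (\<mu> + 1)" "?T S2 \<in> carrier_mat (\<mu> + 1) \<mu>"
    "?T H2 \<in> carrier_mat (\<mu> + 1) 1" "?T b \<in> carrier_mat 1 (\<mu> + 1)"
    using 2 S ab by simp_all
  have r1: "r1 = N * n" and c1: "c1 = (N + 1) * n"
    using N by (simp_all add: r1_def c1_def)
  have carr1: "K1 \<in> carrier_mat r1 c1" "kron_id n G1 \<in> carrier_mat c1 r1" "N1 \<in> carrier_mat c1 n"
    "kron_id n H1 \<in> carrier_mat n c1"
    unfolding r1 c1 K1 N1_def using S(1) ab(1) 1(1,2) kron_id_carrier[of a "N + 1" 1 n]
      kron_id_carrier[of H1 1 "N + 1" n]
    by (simp_all only: kron_id_carrier mult_1)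
  have carr2: "K2T \<in> carrier_mat c2 r2" "kron_id m (?T G2) \<in> carrier_mat r2 c2" "N2 \<in> carrier_mat m c2"
    "kron_id m (?T H2) \<in> carrier_mat c2 m"
    unfolding r2_def c2_def K2T N2_def using T2c kron_id_carrier[of "?T b" 1 "\<mu> + 1" m]
      kron_id_carrier[of "?T H2" "\<mu> + 1" 1 m]
    by (simp_all only: kron_id_carrier mult_1)
  have eq1: "K1 * kron_id n G1 = 1\<^sub>m r1" "K1 * N1 = 0\<^sub>m r1 n" "kron_id n H1 * kron_id n G1 = 0\<^sub>m n r1"
    "kron_id n H1 * N1 = 1\<^sub>m n"
    unfolding K1 N1_def r1
    using kron_id_mult[OF S(1) 1(1)] kron_id_mult[OF S(1) ab(1)] kron_id_mult[OF 1(2) 1(1)]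
      kron_id_mult[OF 1(2) ab(1)]
    by (simp_all only: 1 Sa kron_id_one kron_id_zero mult_1)
  have eq2: "kron_id m (?T G2) * K2T = 1\<^sub>m r2" "N2 * K2T = 0\<^sub>m m r2"
    "kron_id m (?T G2) * kron_id m (?T H2) = 0\<^sub>m r2 m" "N2 * kron_id m (?T H2) = 1\<^sub>m m"
    unfolding K2T N2_def r2_def
    using kron_id_mult[OF T2c(1,2)] kron_id_mult[OF T2c(4,2)] kron_id_mult[OF T2c(1,3)]
      kron_id_mult[OF T2c(4,3)]
    by (simp_all only: T2 kron_id_one kron_id_zero mult_1)
  have Mc: "M \<in> carrier_mat c2 c1"
    unfolding M_def c2_def c1_def by (rule gen_carrier(3)[OF mu])
  have Ac: "const_mat A \<in> carrier_mat c2 r1" and Bc: "const_mat B \<in> carrier_mat r2 c1"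
    using A B by (simp_all add: r1_def r2_def c1_def c2_def)
  have AK: "const_mat A * K1 \<in> carrier_mat c2 c1" and KB: "K2T * const_mat B \<in> carrier_mat c2 c1"
    using Ac Bc carr1(1) carr2(1) by auto
  have Xc: "X \<in> carrier_mat c2 c1"
    unfolding X_def using AK KB by simp
  \<comment> \<open>The term with \<open>A\<close> vanishes here, since \<open>K1 * N1 = 0\<close>;
    the one with \<open>B\<close> is carried along until \<open>N2\<close> meets \<open>K2T\<close>
    from the left.\<close>
  have "X * N1 = M * N1 + const_mat A * K1 * N1 + K2T * const_mat B * N1"
    unfolding X_def
    by (simp only: add_mult_distrib_mat[OF add_carrier_mat[OF AK] KB carr1(3)]
        add_mult_distrib_mat[OF Mc AK carr1(3)])
  also have "const_mat A * K1 * N1 = 0\<^sub>m c2 n"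
    using Ac by (simp add: assoc_mult_mat[OF Ac carr1(1) carr1(3)] eq1)
  finally have XN: "X * N1 = M * N1 + K2T * (const_mat B * N1)"
    using Mc carr1(3) by (simp add: assoc_mult_mat[OF carr2(1) Bc carr1(3)] right_add_zero_mat[of _ c2 n])
  have BN: "const_mat B * N1 \<in> carrier_mat r2 n" and MN: "M * N1 \<in> carrier_mat c2 n"
    using Bc Mc carr1(3) by auto
  have "N2 * (X * N1) = N2 * (M * N1) + N2 * K2T * (const_mat B * N1)"
    unfolding XN using mult_add_distrib_mat[OF carr2(3) MN mult_carrier_mat[OF carr2(1) BN]]
      assoc_mult_mat[OF carr2(3) carr2(1) BN] by simp
  also have "\<dots> = N2 * (M * N1)"
    using eq2(2) left_mult_zero_mat[OF BN, of m] right_add_zero_mat[OF mult_carrier_mat[OF carr2(3) MN]]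
    by simp
  also have "\<dots> = gen_P m n k g C"
    unfolding N2_def M_def N1_def a_def b_def N_def by (rule gen_M_dual[OF C mu])
  finally have XP: "N2 * (X * N1) = gen_P m n k g C" .
  have L: "gen_L m n k \<mu> g C A B = four_block_mat X K2T K1 (0\<^sub>m r1 r2)"
    by (simp add: gen_L_def X_def M_def K1_def K2T_def r1_def r2_def)
  have Ldim: "dim_row (gen_L m n k \<mu> g C A B) = c2 + r1" "dim_col (gen_L m n k \<mu> g C A B) = c1 + r2"
    and Pdim: "dim_row (gen_P m n k g C) = m" "dim_col (gen_P m n k g C) = n"
    using Xc by (simp_all add: L gen_P_def)
  have "c1 = r1 + n" "c2 = r2 + m"
    using N by (simp_all add: r1 c1 r2_def c2_def)
  from block_minimal_bases_equivalence[OF this Xc carr1 eq1 carr2 eq2]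
  show ?thesis
    unfolding is_linearization_def Ldim Pdim unfolding L[symmetric] XP
    using pencil_gen_L[where C = C and g = g, OF C mu A B g] by blast
qed

section \<open>The Lagrange factors and their reversals\<close>

text \<open>The combination with coefficients \<open>d\<close> and \<open>- b\<close> eliminates the
  variable and leaves the constant \<open>a * d - b * c\<close>. Leading coefficients may vanish, as
  happens for the reversal at a node 0.\<close>

lemma comaximal_linear:
  fixes a b c d :: "'a :: field"
  assumes "a * d \<noteq> b * c"
  shows "comaximal [:a, b:] [:c, d:]"
proof -
  have "a * d - b * c \<noteq> 0"
    using assms by simp
  then have "[:d / (a * d - b * c):] * [:a, b:] + [:- b / (a * d - b * c):] * [:c, d:] = 1"
    by (simp add: one_pCons divide_simps)
  then show ?thesis
    unfolding comaximal_def by blast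
qed

theorem theorem4p4:
  fixes k m n \<mu> :: nat
    and x :: "nat \<Rightarrow> complex"
    and P :: "nat \<Rightarrow> complex mat"
    and A B :: "complex mat"
  assumes "k \<ge> 1" and "m \<ge> 1" and "n \<ge> 1"
    and "inj_on x {1..k + 1}"
    and "\<And>i. i \<in> {1..k + 1} \<Longrightarrow> P i \<in> carrier_mat m n"
    and "\<mu> \<le> k - 1"
    and "A \<in> carrier_mat ((\<mu> + 1) * m) ((k - \<mu> - 1) * n)"
    and "B \<in> carrier_mat (\<mu> * m) ((k - \<mu>) * n)"
  shows "is_strong_linearization k (L_lagrange m n k \<mu> x P A B) (lagrange_mat m n k x P)"
proof -
  let ?C = "\<lambda>i. bary_weight k x i \<cdot>\<^sub>m P i" and ?g = "node_factor x"
    and ?h = "\<lambda>i. rev_grade 1 (node_factor x i)"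
  have mu: "\<mu> < k"
    using assms(1,6) by simp
  have C: "?C i \<in> carrier_mat m n" if "i \<in> {1..k + 1}" for i
    using assms(5)[OF that] by simp
  have g: "degree (?g i) \<le> 1" and h: "degree (?h i) \<le> 1" for i
    using degree_rev_grade_le[of 1] by (simp_all add: node_factor_def)
  \<comment> \<open>For the node 0 this is the constant 1, whereas the reversal of grade 0 would not
    even apply to a factor of degree 1.\<close>
  have h_eq: "?h i = [:1, - x i:]" for i
    by (simp add: node_factor_def rev_grade_def monom_altdef)
  have P: "lagrange_mat m n k x P = gen_P m n k ?g ?C"
    by (rule lagrange_mat_eq) (fact assms(5))
  \<comment> \<open>The determinants required by \<open>comaximal_linear\<close> are
    \<open>x j - x i\<close> for the factors and \<open>x i - x j\<close> for their reversals, both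
    nonzero as the nodes are distinct.\<close>
  have comax: "comaximal (?g i) (?g j)" "comaximal (?h i) (?h j)"
    if "i \<in> {1..k + 1}" "j \<in> {1..k + 1}" "i \<noteq> j" for i j
    using inj_onD[OF assms(4) _ that(1,2)] that(3) unfolding h_eq
    by (auto simp: node_factor_def intro!: comaximal_linear)
  have "is_linearization (gen_L m n k \<mu> ?g ?C A B) (gen_P m n k ?g ?C)"
    by (rule is_linearization_gen_L) (fact C mu assms(7,8) g comax(1))+
  moreover have "is_linearization (gen_L m n k \<mu> ?h ?C A B) (gen_P m n k ?h ?C)"
    by (rule is_linearization_gen_L) (fact C mu assms(7,8) h comax(2))+
  moreover have "rev_mat 1 (gen_L m n k \<mu> ?g ?C A B) = gen_L m n k \<mu> ?h ?C A B"
    by (rule rev_mat_gen_L) (fact C mu assms(7,8))+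
  moreover have "rev_mat k (gen_P m n k ?g ?C) = gen_P m n k ?h ?C"
    by (rule rev_mat_gen_P) (fact g)
  moreover have "has_grade k (gen_P m n k ?g ?C)"
    by (rule has_grade_gen_P) (fact g)
  ultimately show ?thesis
    by (simp only: is_strong_linearization_def L_lagrange_eq[OF mu] P simp_thms)
qed

end
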